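(* Let $F\in\mathrm{Diff}(\mathbb{C}^2,0)$ be such that $0$ is an isolated fixed point of $F^m$ for every integer $m\ge 1$. Then $F$ does not satisfy the finite orbits property.
   Context: $\mathrm{Diff}(\mathbb{C}^2,0)$ is the group of germs at $0$ of biholomorphisms of $\mathbb{C}^2$ fixing $0$. For a representative $F:U\to V$ (a biholomorphism between open neighborhoods of $0$ with $F(0)=0$), $A\subset U\cap V$ and $p\in A$, put $O^+_{F,A}(p)=\{F^j(p): j\ge 0,\ F^k(p)\in A\text{ for all }0\le k\le j\}$ and $O_{F,A}(p)=O^+_{F,A}(p)\cup O^+_{F^{-1},A}(p)$. $F$ has the finite orbits property in $A$ if $O_{F,A}(p)$ is finite for all $p\in A$. A germ $F$ has the finite orbits property if there exist a representative $F:U\to V$ and a neighborhood $A\subset U\cap V$ of $0$ such that $F$ has the finite orbits property in $A$. *)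

theory Defs
  imports "HOL-Analysis.Analysis"
begin

(* Holomorphy in several variables as complex Frechet differentiability on an open set:
   the derivative at each point is given by a complex matrix, the Jacobian. *)
definition holomorphic_map_on :: "(complex^2 \<Rightarrow> complex^2) \<Rightarrow> (complex^2) set \<Rightarrow> bool" where
  "holomorphic_map_on f U \<longleftrightarrow>
     open U \<and> (\<forall>p\<in>U. \<exists>J :: complex^2^2. (f has_derivative (\<lambda>v. J *v v)) (at p))"

(* The values of f outside U are irrelevant. *)
definition biholomorphism :: "(complex^2 \<Rightarrow> complex^2) \<Rightarrow> (complex^2) set \<Rightarrow> (complex^2) set \<Rightarrow> bool" where
  "biholomorphism f U V \<longleftrightarrow>
     bij_betw f U V \<and> holomorphic_map_on f U \<and> holomorphic_map_on (inv_into U f) V"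

definition local_biholomorphism :: "(complex^2 \<Rightarrow> complex^2) \<Rightarrow> (complex^2) set \<Rightarrow> (complex^2) set \<Rightarrow> bool" where
  "local_biholomorphism f U V \<longleftrightarrow> biholomorphism f U V \<and> 0 \<in> U \<and> 0 \<in> V \<and> f 0 = 0"

definition germ_rel :: "(complex^2 \<Rightarrow> complex^2) \<Rightarrow> (complex^2 \<Rightarrow> complex^2) \<Rightarrow> bool" where
  "germ_rel f g \<longleftrightarrow> (\<exists>U V. local_biholomorphism f U V) \<and> (\<exists>U V. local_biholomorphism g U V) \<and>
     eventually (\<lambda>z. f z = g z) (nhds 0)"

lemma biholomorphismI:
  assumes "holomorphic_map_on f U" "holomorphic_map_on g V" "f ` U \<subseteq> V" "g ` V \<subseteq> U"
    and "\<And>x. x \<in> U \<Longrightarrow> g (f x) = x" "\<And>y. y \<in> V \<Longrightarrow> f (g y) = y"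
  shows "biholomorphism f U V"
proof -
  have bij: "bij_betw f U V"
    by (rule bij_betw_byWitness[where f' = g]) (use assms in auto)
  have inv: "inv_into U f y = g y" if "y \<in> V" for y
    using that assms bij by (metis bij_betw_inv_into_left image_subset_iff)
  have "holomorphic_map_on (inv_into U f) V"
    unfolding holomorphic_map_on_def
  proof (intro conjI ballI)
    show oV: "open V" using assms(2) by (simp add: holomorphic_map_on_def)
    fix p assume p: "p \<in> V"
    then obtain J :: "complex^2^2" where "(g has_derivative (\<lambda>v. J *v v)) (at p)"
      using assms(2) by (auto simp: holomorphic_map_on_def)
    then have "(inv_into U f has_derivative (\<lambda>v. J *v v)) (at p)"
      by (rule has_derivative_transform_within_open[OF _ oV p]) (simp add: inv)
    then show "\<exists>J :: complex^2^2. (inv_into U f has_derivative (\<lambda>v. J *v v)) (at p)" ..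
  qed
  with bij assms(1) show ?thesis by (simp add: biholomorphism_def)
qed

lemma holomorphic_map_on_continuous:
  "holomorphic_map_on f U \<Longrightarrow> continuous_on U f"
  unfolding holomorphic_map_on_def
  by (meson continuous_at_imp_continuous_on has_derivative_continuous)

lemma holomorphic_map_on_compose:
  assumes f: "holomorphic_map_on f U" and g: "holomorphic_map_on g V"
  shows "holomorphic_map_on (g \<circ> f) (U \<inter> f -` V)"
  unfolding holomorphic_map_on_def
proof (intro conjI ballI)
  show "open (U \<inter> f -` V)"
    using f g holomorphic_map_on_continuous[OF f]
    by (metis continuous_on_open_vimage holomorphic_map_on_def inf_commute)
  fix p assume p: "p \<in> U \<inter> f -` V"
  obtain J K :: "complex^2^2" where "(f has_derivative (\<lambda>v. J *v v)) (at p)"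
    "(g has_derivative (\<lambda>v. K *v v)) (at (f p))"
    using p f g unfolding holomorphic_map_on_def by blast
  then have "(g \<circ> f has_derivative (\<lambda>v. K *v v) \<circ> (\<lambda>v. J *v v)) (at p)"
    by (rule diff_chain_at)
  then have "(g \<circ> f has_derivative (\<lambda>v. (K ** J) *v v)) (at p)"
    by (simp add: o_def matrix_vector_mul_assoc)
  then show "\<exists>J :: complex^2^2. (g \<circ> f has_derivative (\<lambda>v. J *v v)) (at p)" ..
qed

lemma local_biholomorphism_compose:
  assumes f: "local_biholomorphism f U V" and g: "local_biholomorphism g U' V'"
  shows "local_biholomorphism (g \<circ> f) (U \<inter> f -` U') (V' \<inter> inv_into U' g -` V)"
proof -
  let ?f' = "inv_into U f" and ?g' = "inv_into U' g"
  have F: "bij_betw f U V" "holomorphic_map_on f U" "holomorphic_map_on ?f' V" "0 \<in> U" "0 \<in> V" "f 0 = 0"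
    using f by (auto simp: local_biholomorphism_def biholomorphism_def)
  have G: "bij_betw g U' V'" "holomorphic_map_on g U'" "holomorphic_map_on ?g' V'" "0 \<in> U'" "0 \<in> V'" "g 0 = 0"
    using g by (auto simp: local_biholomorphism_def biholomorphism_def)
  have Ff: "f x \<in> V" "?f' (f x) = x" if "x \<in> U" for x
    using that F(1) by (auto simp: bij_betw_apply bij_betw_inv_into_left)
  have Fi: "?f' x \<in> U" "f (?f' x) = x" if "x \<in> V" for x
    using that F(1) by (auto simp: bij_betw_inv_into_right bij_betw_def inv_into_into)
  have Gf: "g x \<in> V'" "?g' (g x) = x" if "x \<in> U'" for x
    using that G(1) by (auto simp: bij_betw_apply bij_betw_inv_into_left)
  have Gi: "?g' x \<in> U'" "g (?g' x) = x" if "x \<in> V'" for x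
    using that G(1) by (auto simp: bij_betw_inv_into_right bij_betw_def inv_into_into)
  have "biholomorphism (g \<circ> f) (U \<inter> f -` U') (V' \<inter> ?g' -` V)"
    by (rule biholomorphismI[where g = "?f' \<circ> ?g'"])
       (auto intro!: holomorphic_map_on_compose F G simp: Ff Fi Gf Gi)
  moreover have "?g' 0 = 0" using Gf(2)[of 0] G by simp
  ultimately show ?thesis using F G by (simp add: local_biholomorphism_def)
qed

lemma local_biholomorphism_id: "local_biholomorphism id UNIV UNIV"
proof -
  have "(id has_derivative (\<lambda>v. mat 1 *v v)) (at p)" for p :: "complex^2"
    by (simp add: id_def)
  then have "holomorphic_map_on id UNIV"
    unfolding holomorphic_map_on_def by blast
  then show ?thesis
    unfolding local_biholomorphism_def by (auto intro: biholomorphismI[where g = id])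
qed

lemma germ_rel_part_equivp: "part_equivp germ_rel"
proof (rule part_equivpI)
  show "\<exists>f. germ_rel f f"
    using local_biholomorphism_id unfolding germ_rel_def by (intro exI[of _ id]) auto
  show "symp germ_rel"
    by (rule sympI) (auto simp: germ_rel_def eq_commute)
  show "transp germ_rel"
    by (rule transpI) (auto simp: germ_rel_def elim: eventually_elim2)
qed

(* The type of all germs at 0 of biholomorphisms of C^2 fixing 0, i.e. Diff(C^2,0). *)
quotient_type diff_germ = "complex^2 \<Rightarrow> complex^2" / partial: germ_rel
  by (rule germ_rel_part_equivp)

lemma germ_rel_compose:
  assumes "germ_rel f f'" "germ_rel g g'"
  shows "germ_rel (f \<circ> g) (f' \<circ> g')"
proof -
  obtain U V where g: "local_biholomorphism g U V"
    using assms(2) by (auto simp: germ_rel_def)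
  then have "(g has_derivative (\<lambda>v. J *v v)) (at 0) \<Longrightarrow> isCont g 0" for J :: "complex^2^2"
    by (simp add: has_derivative_continuous)
  with g have "isCont g 0"
    unfolding local_biholomorphism_def biholomorphism_def holomorphic_map_on_def by blast
  then have "filterlim g (nhds 0) (nhds 0)"
    using g by (simp add: isCont_def local_biholomorphism_def tendsto_at_iff_tendsto_nhds)
  moreover have "eventually (\<lambda>z. f z = f' z) (nhds 0)"
    using assms(1) by (simp add: germ_rel_def)
  ultimately have "eventually (\<lambda>z. f (g z) = f' (g z)) (nhds 0)"
    unfolding filterlim_iff by blast
  moreover have "eventually (\<lambda>z. g z = g' z) (nhds 0)"
    using assms(2) by (simp add: germ_rel_def)
  ultimately have "eventually (\<lambda>z. (f \<circ> g) z = (f' \<circ> g') z) (nhds 0)"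
    by eventually_elim simp
  with assms show ?thesis
    unfolding germ_rel_def by (blast intro: local_biholomorphism_compose)
qed

(* Multiplication is composition, so that F ^ m is the m-th iterate of the germ F. *)
instantiation diff_germ :: monoid_mult
begin

lift_definition one_diff_germ :: diff_germ is id
  using local_biholomorphism_id by (auto simp: germ_rel_def)

lift_definition times_diff_germ :: "diff_germ \<Rightarrow> diff_germ \<Rightarrow> diff_germ" is "(\<circ>)"
  by (rule germ_rel_compose)

instance
proof
  fix a b c :: diff_germ
  show "a * b * c = a * (b * c)"
    by transfer (metis comp_assoc germ_rel_compose)
  show "1 * a = a" by transfer simp
  show "a * 1 = a" by transfer simp
qed

end

lift_definition isolated_fixed_point_0 :: "diff_germ \<Rightarrow> bool" is
  "\<lambda>f. 0 isolated_in {z. f z = z}"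
proof -
  have imp: "0 isolated_in {z. g z = z}"
    if "germ_rel f g" "0 isolated_in {z. f z = z}" for f g
  proof -
    from that(1) obtain S where S: "open S" "0 \<in> S" "\<And>z. z \<in> S \<Longrightarrow> f z = g z"
      unfolding germ_rel_def eventually_nhds by blast
    from that(2) obtain T where T: "open T" "T \<inter> {z. f z = z} = {0}"
      unfolding isolated_in_def by blast
    have "(S \<inter> T) \<inter> {z. g z = z} = S \<inter> (T \<inter> {z. f z = z})"
      using S(3) by auto
    also have "\<dots> = {0}" using T(2) S(2) by auto
    finally have "(S \<inter> T) \<inter> {z. g z = z} = {0}" .
    moreover have "open (S \<inter> T)" using S T by blast
    ultimately show ?thesis unfolding isolated_in_def by blast
  qed
  fix f g assume "germ_rel f g"
  moreover from this have "germ_rel g f"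
    by (auto simp: germ_rel_def eq_commute)
  ultimately show "0 isolated_in {z. f z = z} \<longleftrightarrow> 0 isolated_in {z. g z = z}"
    using imp by blast
qed

definition representative :: "diff_germ \<Rightarrow> (complex^2 \<Rightarrow> complex^2) \<Rightarrow> (complex^2) set \<Rightarrow> (complex^2) set \<Rightarrow> bool" where
  "representative F f U V \<longleftrightarrow> local_biholomorphism f U V \<and> abs_diff_germ f = F"

definition pos_orbit :: "(complex^2 \<Rightarrow> complex^2) \<Rightarrow> (complex^2) set \<Rightarrow> complex^2 \<Rightarrow> (complex^2) set" where
  "pos_orbit f A p = {(f ^^ j) p | j. \<forall>k\<le>j. (f ^^ k) p \<in> A}"

(* For A contained in both U and f ` U, the iterates of f and of its inverse that occur here
   only involve values inside the respective domains. *)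
definition orbit_in :: "(complex^2 \<Rightarrow> complex^2) \<Rightarrow> (complex^2) set \<Rightarrow> (complex^2) set \<Rightarrow> complex^2 \<Rightarrow> (complex^2) set" where
  "orbit_in f U A p = pos_orbit f A p \<union> pos_orbit (inv_into U f) A p"

definition finite_orbits_in :: "(complex^2 \<Rightarrow> complex^2) \<Rightarrow> (complex^2) set \<Rightarrow> (complex^2) set \<Rightarrow> bool" where
  "finite_orbits_in f U A \<longleftrightarrow> (\<forall>p\<in>A. finite (orbit_in f U A p))"

definition finite_orbits_property :: "diff_germ \<Rightarrow> bool" where
  "finite_orbits_property F \<longleftrightarrow>
     (\<exists>f U V A. representative F f U V \<and> A \<subseteq> U \<inter> V \<and> 0 \<in> interior A \<and> finite_orbits_in f U A)"

end

theory Submission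
  imports Defs "HOL-Complex_Analysis.Complex_Analysis"
begin

text \<open>
  Suppose \<open>f\<close> has finite orbits. By a connectedness argument, in every small ball the points whose
  \<open>f\<close>-orbit (or whose orbit under the inverse) stays in the ball contain a continuum \<open>K\<close> joining \<open>0\<close>
  to the boundary, and finiteness of orbits makes every point of \<open>K\<close> periodic. Attach to a fixed point
  of \<open>f ^^ fact N\<close> the trace and determinant of the Jacobian. This invariant is locally constant on the
  fixed points except where it equals \<open>(2, 1)\<close>: a non-isolated fixed point with multiplier \<open>\<noteq> 1\<close> lies on
  a holomorphic disc of fixed points along which the determinant is holomorphic, and it has modulus \<open>1\<close>
  there because a semi-attracting fixed point, for the map or its inverse, has infinite orbits nearby.
  Moreover, if no root of unity other than \<open>1\<close> is an eigenvalue, then iterates have no new fixed points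
  nearby. Hence the continuum is partitioned into countably many closed sets, each consisting of
  fixed points of a single iterate, and by Sierpinski's theorem it lies in one of them. So \<open>0\<close> is not
  an isolated fixed point of that iterate.
\<close>

section \<open>Continua\<close>

text \<open>The sets \<open>periodic N\<close> are compact and cover the continuum, but Baire's
  theorem would only give a common period on some relatively open part of it, possibly far from 0.
  Sierpinski's theorem gives a common period on all of it, at the price of needing disjoint closed
  pieces, whereas the sets \<open>periodic N\<close> increase along with \<open>N\<close>. Removing
  the earlier levels keeps a piece closed only if these are relatively open in it. Two things could
  prevent this: a higher iterate may have new fixed points accumulating at an old one, and, roots of
  unity being dense in the circle, the condition on the eigenvalues need not persist at nearby
  points. The first is excluded because I + J + ... + J^(l-1) is invertible when no eigenvalue of J
  is a root of unity other than 1; the second by local constancy of the invariant. The value (2, 1),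
  both eigenvalues equal to 1, escapes the second argument, since the fixed points need not form a
  disc there. It is rescued by arithmetic: where a higher level has the value (2, 1), the
  eigenvalues at a lower level are roots of unity of bounded order, so only finitely many values
  occur and continuity separates them.\<close>

lemma continuum_avoids_closed_piece:
  fixes K :: "'a::euclidean_space set"
  assumes K: "compact K" "connected K" "K \<noteq> {}" "K \<subseteq> \<Union>\<U>"
    and disj: "pairwise disjnt \<U>" and cl: "\<And>C. C \<in> \<U> \<Longrightarrow> closed C"
    and nsub: "\<And>C. C \<in> \<U> \<Longrightarrow> \<not> K \<subseteq> C" and C: "C \<in> \<U>"
  shows "\<exists>L. compact L \<and> connected L \<and> L \<noteq> {} \<and> L \<subseteq> K \<and> L \<inter> C = {} \<and> (\<forall>D\<in>\<U>. \<not> L \<subseteq> D)"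
proof (cases "K \<inter> C = {}")
  case True
  then show ?thesis using K nsub by blast
next
  case False
  obtain x where x: "x \<in> K" "x \<notin> C" using nsub[OF C] by blast
  then obtain D where D: "D \<in> \<U>" "x \<in> D" using K(4) by blast
  have CD: "D \<inter> C = {}"
    using disj C D x(2) by (metis disjnt_def pairwiseD)
  \<comment> \<open>Removing \<open>B\<close> from \<open>K\<close> will avoid \<open>C\<close>,
    while \<open>A\<close> keeps the points of \<open>D\<close> in the relative interior of what
    remains.\<close>
  then obtain A B where AB: "open A" "open B" "D \<subseteq> A" "C \<subseteq> B" "A \<inter> B = {}"
    using separation_normal[OF cl[OF D(1)] cl[OF C]] by metis
  define S where "S = K - B"
  have "compact S" unfolding S_def using K(1) AB(2) by (rule compact_diff)
  have xS: "x \<in> S" using x(1) D(2) AB by (auto simp: S_def)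
  let ?X = "top_of_set K"
  let ?L = "connected_component_set S x"
  have Ssub: "S \<subset> K"
    using False AB(4) by (auto simp: S_def)
  have L: "?L \<in> connected_components_of (subtopology ?X S)"
  proof -
    have "subtopology ?X S = top_of_set S"
      using Ssub by (simp add: subtopology_subtopology Int_absorb1 psubset_imp_subset)
    then show ?thesis using xS
      by (auto simp: connected_components_of_def connected_component_of_def connectedin_subtopology
          connected_component_def intro!: image_eqI[of _ _ x])
  qed
  \<comment> \<open>Boundary bumping: a component of a proper closed subset of a continuum meets the
    frontier of that subset. Points of \<open>D\<close> are interior to \<open>S\<close>, so the
    component of \<open>x\<close> has a point outside \<open>D\<close>; as it also meets
    \<open>D\<close>, no single piece contains it.\<close>
  have "?L \<inter> ?X frontier_of S \<noteq> {}"
  proof (rule boundary_bumping_theorem_closed[OF _ _ _ _ _ L])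
    show "closedin ?X S" using compact_imp_closed[OF \<open>compact S\<close>] Ssub by (intro closed_subset) auto
    show "connected_space ?X"
      using K(2) by (metis connectedin_def connectedin_iff_connected)
    show "compact_space ?X"
      using K(1) by (simp add: compact_space_subtopology)
    show "Hausdorff_space ?X"
      by (simp add: Hausdorff_space_subtopology)
    show "S \<noteq> topspace ?X" using Ssub by auto
  qed
  then obtain y where y: "y \<in> ?L" "y \<in> ?X frontier_of S" by blast
  have yS: "y \<in> S" using y(1) connected_component_subset by blast
  have "y \<notin> D"
  proof
    assume "y \<in> D"
    moreover have "openin ?X (K \<inter> A)" using AB(1) by (simp add: openin_open_Int)
    moreover have "K \<inter> A \<subseteq> S" using AB by (auto simp: S_def)
    ultimately have "y \<in> ?X interior_of S"
      using yS AB(3) by (metis IntI S_def DiffD1 interior_of_maximal subsetD)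
    then show False using y(2) by (simp add: frontier_of_def)
  qed
  show ?thesis
  proof (intro exI conjI ballI notI)
    show "compact ?L"
      using \<open>compact S\<close> by (metis closed_connected_component compact_Int_closed compact_imp_closed connected_component_subset inf.absorb_iff2)
    show "connected ?L" by simp
    have "x \<in> ?L" using xS by simp
    then show "?L = {} \<Longrightarrow> False" by blast
    show "?L \<subseteq> K" using connected_component_subset[of S x] Ssub by blast
    show "?L \<inter> C = {}" using connected_component_subset[of S x] AB(4) by (auto simp: S_def)
    fix E assume E: "E \<in> \<U>" "?L \<subseteq> E"
    have "x \<in> E" using E(2) xS by auto
    then have "E = D" using disj D E(1) by (metis disjnt_iff pairwiseD)
    then show False using E(2) y(1) \<open>y \<notin> D\<close> by blast
  qed
qed

text \<open>If no piece contained \<open>K\<close>, nested subcontinua could be chosen that avoid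
  the pieces one after another while still lying in no piece. By compactness they share a point,
  which the cover would have to put into some piece.\<close>

theorem Sierpinski_continuum:
  fixes K :: "'a::euclidean_space set"
  assumes K: "compact K" "connected K" "K \<noteq> {}" "K \<subseteq> \<Union>\<U>" and "countable \<U>"
    and disj: "pairwise disjnt \<U>" and cl: "\<And>C. C \<in> \<U> \<Longrightarrow> closed C"
  shows "\<exists>C\<in>\<U>. K \<subseteq> C"
proof (rule ccontr)
  assume neg: "\<not> ?thesis"
  have "\<U> \<noteq> {}" using K by auto
  define c where "c = from_nat_into \<U>"
  have c: "c n \<in> \<U>" for n using \<open>\<U> \<noteq> {}\<close> by (simp add: c_def from_nat_into)
  define P where "P = (\<lambda>(n::nat) L. compact L \<and> connected L \<and> L \<noteq> {} \<and> L \<subseteq> K \<and> (\<forall>D\<in>\<U>. \<not> L \<subseteq> D))"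
  have "\<exists>L. \<forall>n. P n (L n) \<and> (L (Suc n) \<subseteq> L n \<and> L (Suc n) \<inter> c n = {})"
  proof (rule dependent_nat_choice)
    show "\<exists>L. P 0 L" using K neg by (auto simp: P_def)
    fix L n assume L: "P n L"
    have "\<exists>L'. compact L' \<and> connected L' \<and> L' \<noteq> {} \<and> L' \<subseteq> L \<and> L' \<inter> c n = {} \<and> (\<forall>D\<in>\<U>. \<not> L' \<subseteq> D)"
      by (rule continuum_avoids_closed_piece) (use L K(4) disj cl c in \<open>auto simp: P_def\<close>)
    then obtain L' where "compact L'" "connected L'" "L' \<noteq> {}" "L' \<subseteq> L" "L' \<inter> c n = {}" "\<forall>D\<in>\<U>. \<not> L' \<subseteq> D"
      by blast
    moreover have "L \<subseteq> K" using L by (simp add: P_def)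
    ultimately have "P (Suc n) L' \<and> L' \<subseteq> L \<and> L' \<inter> c n = {}" by (simp add: P_def)
    then show "\<exists>L'. P (Suc n) L' \<and> L' \<subseteq> L \<and> L' \<inter> c n = {}" ..
  qed
  then obtain L where L: "\<And>n. P n (L n)" "\<And>n. L (Suc n) \<subseteq> L n" "\<And>n. L (Suc n) \<inter> c n = {}"
    by blast
  have anti: "\<And>m n. m \<le> n \<Longrightarrow> L n \<subseteq> L m"
    using L(2) by (rule lift_Suc_antimono_le)
  have "\<Inter>(range L) \<noteq> {}"
    by (rule compact_nest) (use L(1) anti in \<open>auto simp: P_def\<close>)
  then obtain x where x: "\<And>n. x \<in> L n" by blast
  then have "x \<in> \<Union>\<U>" using L(1)[of 0] K(4) unfolding P_def by blast
  then obtain n where "x \<in> c n"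
    using \<open>countable \<U>\<close> by (metis UnionE c_def from_nat_into_surj)
  then show False using x[of "Suc n"] L(3)[of n] by blast
qed

text \<open>Each set of the partition is the locus where the invariant \<open>\<tau> N\<close>, evaluated at the least
  \<open>N\<close> for which it is good, takes a prescribed value.\<close>

lemma continuum_in_single_stratum:
  fixes K :: "'a::euclidean_space set" and X :: "nat \<Rightarrow> 'a set" and \<tau> :: "nat \<Rightarrow> 'a \<Rightarrow> 'b::metric_space"
  assumes K: "compact K" "connected K" "K \<noteq> {}"
    and X: "\<And>N. compact (X N)"
    and cont: "\<And>N. continuous_on (X N) (\<tau> N)"
    and good_mono: "\<And>N k q. q \<in> X N \<Longrightarrow> good (\<tau> N q) \<Longrightarrow> N \<le> k \<Longrightarrow> q \<in> X k \<and> good (\<tau> k q)"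
    and loc_const: "\<And>N q. q \<in> X N \<Longrightarrow> \<tau> N q \<noteq> e \<Longrightarrow> \<exists>\<epsilon>>0. \<forall>p\<in>X N \<inter> ball q \<epsilon>. \<tau> N p = \<tau> N q"
    and stable: "\<And>N k q. q \<in> X N \<Longrightarrow> good (\<tau> N q) \<Longrightarrow> N \<le> k \<Longrightarrow> \<exists>\<epsilon>>0. X k \<inter> ball q \<epsilon> \<subseteq> X N"
    and e_good: "good e"
    and e_up: "\<And>N k q. q \<in> X N \<Longrightarrow> \<tau> N q = e \<Longrightarrow> N \<le> k \<Longrightarrow> \<tau> k q = e"
    and e_down: "\<And>N k. N \<le> k \<Longrightarrow> \<exists>Z. finite Z \<and> (\<forall>q\<in>X N. \<tau> k q = e \<longrightarrow> \<tau> N q \<in> Z)"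
    and cover: "\<And>q. q \<in> K \<Longrightarrow> \<exists>N. q \<in> X N \<and> good (\<tau> N q)"
  shows "\<exists>N. K \<subseteq> X N"
proof -
  define T where "T = (\<lambda>N. {q \<in> X N. good (\<tau> N q)})"
  \<comment> \<open>On \<open>D N c\<close> the level \<open>N\<close> is the first good one. This
    makes the pieces disjoint; their closedness is the real issue.\<close>
  define D where "D = (\<lambda>N c. {q \<in> X N. \<tau> N q = c} - (\<Union>M<N. T M))"
  define \<U> where "\<U> = (\<Union>N. \<Union>c\<in>{c \<in> \<tau> N ` X N. good c}. {D N c})"
  \<comment> \<open>Where the value is not \<open>e\<close>, it is constant on the part of
    \<open>X N\<close> in some basic open set, so a member of the countable base determines it;
    \<open>SOME\<close> picks a point at which to read it off.\<close>
  have cnt: "countable (\<tau> N ` X N)" for N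
  proof -
    obtain \<B> :: "'a set set" where \<B>: "countable \<B>" "topological_basis \<B>"
      using ex_countable_basis by blast
    have "\<tau> N q \<in> insert e ((\<lambda>B. \<tau> N (SOME p. p \<in> X N \<inter> B)) ` \<B>)" if q: "q \<in> X N" for q
    proof (cases "\<tau> N q = e")
      case False
      then obtain \<epsilon> where \<epsilon>: "\<epsilon> > 0" "\<And>p. p \<in> X N \<inter> ball q \<epsilon> \<Longrightarrow> \<tau> N p = \<tau> N q"
        using loc_const[OF q] by blast
      obtain B where B: "B \<in> \<B>" "q \<in> B" "B \<subseteq> ball q \<epsilon>"
        using topological_basisE[OF \<B>(2) open_ball, of q q \<epsilon>] \<epsilon>(1) by auto
      have "(SOME p. p \<in> X N \<inter> B) \<in> X N \<inter> B"
        using q B(2) by (metis IntI someI_ex)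
      then have "\<tau> N (SOME p. p \<in> X N \<inter> B) = \<tau> N q" using \<epsilon>(2) B(3) by blast
      then show ?thesis using B(1) by (metis image_eqI insertI2)
    qed simp
    then have "\<tau> N ` X N \<subseteq> insert e ((\<lambda>B. \<tau> N (SOME p. p \<in> X N \<inter> B)) ` \<B>)" by blast
    then show ?thesis using \<B>(1) by (meson countable_image countable_insert countable_subset)
  qed
  have "countable \<U>"
    unfolding \<U>_def using cnt by (intro countable_UN) (auto intro: countable_subset[OF _ cnt])
  have disj: "pairwise disjnt \<U>"
  proof (rule pairwiseI)
    fix A B assume AB: "A \<in> \<U>" "B \<in> \<U>" "A \<noteq> B"
    then obtain N c M d where *: "A = D N c" "B = D M d" "good c" "good d"
      by (auto simp: \<U>_def)
    have "False" if q: "q \<in> A" "q \<in> B" for q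
    proof -
      have 1: "q \<in> T N" "q \<in> T M" "\<tau> N q = c" "\<tau> M q = d"
        using q * by (auto simp: D_def T_def)
      have "\<not> N < M" "\<not> M < N" using q 1 * by (auto simp: D_def)
      then show False using 1 * AB(3) by auto
    qed
    then show "disjnt A B" by (auto simp: disjnt_iff)
  qed
  have closed: "closed C" if "C \<in> \<U>" for C
  proof -
    obtain N c where C: "C = D N c" "good c" using \<open>C \<in> \<U>\<close> by (auto simp: \<U>_def)
    let ?P = "{q \<in> X N. \<tau> N q = c}"
    have clP: "closed ?P"
      using continuous_closed_preimage_constant[OF cont compact_imp_closed[OF X]] .
    \<comment> \<open>Each earlier good locus is relatively open in the level set \<open>?P\<close>,
      so removing it leaves a closed set. Near \<open>q\<close>, \<open>stable\<close> puts the
      points of \<open>?P\<close> into \<open>X M\<close>; it remains to see that goodness at level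
      \<open>M\<close> persists.\<close>
    have op: "\<exists>\<epsilon>>0. ?P \<inter> ball q \<epsilon> \<subseteq> T M" if M: "M < N" and q: "q \<in> ?P" "q \<in> T M" for M q
    proof -
      have qM: "q \<in> X M" "good (\<tau> M q)" using q(2) by (auto simp: T_def)
      obtain \<epsilon> where \<epsilon>: "\<epsilon> > 0" "X N \<inter> ball q \<epsilon> \<subseteq> X M"
        using stable[OF qM] M by (meson less_imp_le_nat)
      show ?thesis
      proof (cases "\<tau> M q = e")
        case False
        then obtain \<eta> where \<eta>: "\<eta> > 0" "\<forall>p\<in>X M \<inter> ball q \<eta>. \<tau> M p = \<tau> M q"
          using loc_const[OF qM(1)] by blast
        have "?P \<inter> ball q (min \<epsilon> \<eta>) \<subseteq> T M"
          using \<epsilon>(2) \<eta>(2) qM(2) by (force simp: T_def)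
        moreover have "min \<epsilon> \<eta> > 0" using \<epsilon>(1) \<eta>(1) by simp
        ultimately show ?thesis by blast
      next
        \<comment> \<open>No local constancy at the exceptional value. But \<open>\<tau> N\<close>
          is \<open>e\<close> on all of \<open>?P\<close>, so by \<open>e_down\<close> only the
          finitely many values in \<open>Z\<close> are possible for \<open>\<tau> M\<close> there,
          and continuity leaves only \<open>e\<close> near \<open>q\<close>.\<close>
        case True
        then have "c = e" using e_up[OF qM(1) True, of N] M q(1) by auto
        obtain Z where Z: "finite Z" "\<And>p. p \<in> X M \<Longrightarrow> \<tau> N p = e \<Longrightarrow> \<tau> M p \<in> Z"
          using e_down[of M N] M by auto
        have "open (- (Z - {e}))" using Z(1) by (intro open_Compl finite_imp_closed) simp
        moreover have "\<tau> M q \<in> - (Z - {e})" using True by simp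
        ultimately have "\<exists>\<eta>>0. ball (\<tau> M q) \<eta> \<subseteq> - (Z - {e})"
          by (meson openE)
        then obtain \<eta> where \<eta>: "\<eta> > 0" "ball (\<tau> M q) \<eta> \<subseteq> - (Z - {e})" by blast
        obtain \<delta> where \<delta>: "\<delta> > 0" "\<And>p. p \<in> X M \<Longrightarrow> dist p q < \<delta> \<Longrightarrow> dist (\<tau> M p) (\<tau> M q) < \<eta>"
          using cont[of M] qM(1) \<eta>(1) unfolding continuous_on_iff by meson
        have "p \<in> T M" if p: "p \<in> ?P \<inter> ball q (min \<epsilon> \<delta>)" for p
        proof -
          have pM: "p \<in> X M" using p \<epsilon>(2) by auto
          then have "\<tau> M p \<in> ball (\<tau> M q) \<eta>" using p \<delta>(2)[OF pM] by (simp add: dist_commute)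
          then have "\<tau> M p \<notin> Z - {e}" using \<eta>(2) by blast
          moreover have "\<tau> M p \<in> Z" using Z(2)[OF pM] p \<open>c = e\<close> by simp
          ultimately show ?thesis using pM e_good by (simp add: T_def)
        qed
        then have "?P \<inter> ball q (min \<epsilon> \<delta>) \<subseteq> T M" by blast
        moreover have "min \<epsilon> \<delta> > 0" using \<epsilon>(1) \<delta>(1) by simp
        ultimately show ?thesis by blast
      qed
    qed
    have "closed (?P - T M)" if M: "M < N" for M
    proof -
      have "openin (top_of_set ?P) (?P \<inter> T M)"
        unfolding openin_euclidean_subtopology_iff
      proof (intro conjI ballI)
        fix q assume "q \<in> ?P \<inter> T M"
        then obtain \<epsilon> where "\<epsilon> > 0" "?P \<inter> ball q \<epsilon> \<subseteq> T M" using op[OF M] by blast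
        then show "\<exists>\<epsilon>>0. \<forall>p\<in>?P. dist p q < \<epsilon> \<longrightarrow> p \<in> ?P \<inter> T M"
          by (intro exI[of _ \<epsilon>]) (auto simp: dist_commute subset_iff)
      qed auto
      then have "closedin (top_of_set ?P) (?P - ?P \<inter> T M)"
        by (simp add: closedin_diff)
      then have "closed (?P - ?P \<inter> T M)" using clP by (rule closedin_closed_trans)
      then show ?thesis by (simp add: Diff_Int2 Diff_Int)
    qed
    moreover have "C = ?P \<inter> (\<Inter>M\<in>{..<N}. ?P - T M)"
      unfolding C D_def by auto
    ultimately show "closed C" using clP by (simp only:) (intro closed_Int closed_INT ballI, auto)
  qed
  have cov: "K \<subseteq> \<Union>\<U>"
  proof
    fix q assume "q \<in> K"
    then have "\<exists>N. q \<in> T N" using cover by (auto simp: T_def)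
    then obtain N where N: "q \<in> T N" "\<And>M. M < N \<Longrightarrow> q \<notin> T M"
      using exists_least_iff[of "\<lambda>N. q \<in> T N"] by auto
    then have "q \<in> D N (\<tau> N q)" "D N (\<tau> N q) \<in> \<U>" by (auto simp: D_def T_def \<U>_def)
    then show "q \<in> \<Union>\<U>" by blast
  qed
  obtain C where "C \<in> \<U>" "K \<subseteq> C"
    using Sierpinski_continuum[OF K cov \<open>countable \<U>\<close> disj closed] by blast
  then show ?thesis by (auto simp: \<U>_def D_def)
qed

section \<open>Points whose iterates stay in a ball\<close>

lemma closed_stay_set:
  fixes f :: "'a::euclidean_space \<Rightarrow> 'a"
  assumes "open U" "continuous_on U f" "cball 0 r \<subseteq> U"
  shows "closed {p. \<forall>j\<le>n. (f ^^ j) p \<in> cball 0 r}"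
proof (induction n)
  case (Suc n)
  let ?P = "\<lambda>n. {p. \<forall>j\<le>n. (f ^^ j) p \<in> cball 0 r}"
  have "closed (cball 0 r \<inter> f -` ?P n)"
    using assms Suc by (intro continuous_closed_preimage) (auto intro: continuous_on_subset)
  \<comment> \<open>Peeling off the first step, not the last, uses continuity of \<open>f\<close> on
    the ball only; beyond \<open>U\<close> the iterates are arbitrary.\<close>
  moreover have "?P (Suc n) = cball 0 r \<inter> f -` ?P n"
  proof (intro set_eqI iffI)
    fix p assume p: "p \<in> ?P (Suc n)"
    have "(f ^^ j) (f p) \<in> cball 0 r" if "j \<le> n" for j
    proof -
      have "(f ^^ Suc j) p \<in> cball 0 r" using p that by blast
      then show ?thesis by (simp add: funpow_swap1)
    qed
    moreover have "(f ^^ 0) p \<in> cball 0 r" using p by blast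
    ultimately show "p \<in> cball 0 r \<inter> f -` ?P n" by simp
  next
    fix p assume p: "p \<in> cball 0 r \<inter> f -` ?P n"
    have "(f ^^ j) p \<in> cball 0 r" if "j \<le> Suc n" for j
      using p that by (cases j) (auto simp: funpow_swap1)
    then show "p \<in> ?P (Suc n)" by simp
  qed
  ultimately show ?case by simp
next
  case 0
  have "{p. \<forall>j\<le>0. (f ^^ j) p \<in> cball 0 r} = cball 0 r" by auto
  then show ?case by (metis closed_cball)
qed

lemma continuous_on_funpow_stay:
  fixes f :: "'a::euclidean_space \<Rightarrow> 'a"
  assumes "continuous_on U f" "\<And>p j. p \<in> S \<Longrightarrow> j < n \<Longrightarrow> (f ^^ j) p \<in> U"
  shows "continuous_on S (f ^^ n)"
  using assms(2)
proof (induction n)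
  case (Suc n)
  have "continuous_on S (f \<circ> (f ^^ n))"
    using Suc by (intro continuous_on_compose continuous_on_subset[OF assms(1)]) auto
  then show ?case by simp
qed (simp add: id_def)

lemma open_stay_set:
  fixes f :: "'a::euclidean_space \<Rightarrow> 'a"
  assumes "continuous_on U f" "open W" "W \<subseteq> U"
  shows "open {p. \<forall>j\<le>n. (f ^^ j) p \<in> W}"
proof (induction n)
  case (Suc n)
  let ?P = "{p. \<forall>j\<le>n. (f ^^ j) p \<in> W}"
  have "continuous_on ?P (f ^^ Suc n)"
    using assms(1,3) by (intro continuous_on_funpow_stay) auto
  then have "open (?P \<inter> (f ^^ Suc n) -` W)"
    using Suc assms(2) by (intro continuous_open_preimage)
  moreover have "{p. \<forall>j\<le>Suc n. (f ^^ j) p \<in> W} = ?P \<inter> (f ^^ Suc n) -` W"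
    by (auto simp: le_Suc_eq)
  ultimately show ?case by simp
qed (simp add: assms)

lemma funpow_inverse_cancel:
  assumes "\<And>x. x \<in> W \<Longrightarrow> g (f x) = x" "\<And>j. j < n \<Longrightarrow> (f ^^ j) p \<in> W" "i \<le> n"
  shows "(g ^^ i) ((f ^^ n) p) = (f ^^ (n - i)) p"
  using assms(3)
proof (induction i)
  case (Suc i)
  then have "(g ^^ Suc i) ((f ^^ n) p) = g ((f ^^ (n - i)) p)" by simp
  also have "n - i = Suc (n - Suc i)" using Suc by simp
  also have "g ((f ^^ Suc (n - Suc i)) p) = (f ^^ (n - Suc i)) p"
    using assms(1,2) Suc by simp
  finally show ?case .
qed simp

text \<open>If the conclusion failed, the component of \<open>0\<close> in the set of points that stay in the ball for \<open>2n\<close> steps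
  would, for large \<open>n\<close>, be open as well as closed.\<close>

lemma continuum_of_trapped_points:
  fixes f g :: "'a::euclidean_space \<Rightarrow> 'a"
  assumes f: "open U" "continuous_on U f" and g: "open V" "continuous_on V g"
    and fg: "\<And>x. x \<in> U \<Longrightarrow> g (f x) = x" and gf: "\<And>x. x \<in> V \<Longrightarrow> f (g x) = x"
    and f0: "f 0 = 0" and r: "r > 0" "cball 0 r \<subseteq> U" "cball 0 r \<subseteq> V"
  obtains K where "compact K" "connected K" "0 \<in> K" "K \<inter> sphere 0 r \<noteq> {}"
    "K \<subseteq> {p. \<forall>j. (f ^^ j) p \<in> cball 0 r} \<or> K \<subseteq> {p. \<forall>j. (g ^^ j) p \<in> cball 0 r}"
proof -
  define P where "P = (\<lambda>(f::'a \<Rightarrow> 'a) n. {p. \<forall>j\<le>n. (f ^^ j) p \<in> cball 0 r})"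
  define A where "A = (\<lambda>f n. connected_component_set (P f n) 0)"
  have zero: "(h ^^ j) 0 = 0" if "h 0 = 0" for h :: "'a \<Rightarrow> 'a" and j
    using that by (induction j) auto
  have "0 \<in> cball (0::'a) r" using r(1) by simp
  then have g0: "g 0 = 0" using fg[of 0] f0 r(2) by (metis subsetD)
  have P0: "0 \<in> P h n" if "h 0 = 0" for h n using zero[of h, OF that] r by (auto simp: P_def)
  have Pmono: "P h n \<subseteq> P h m" if "m \<le> n" for h m n using that by (auto simp: P_def)
  have clf: "closed (P f n)" for n unfolding P_def by (rule closed_stay_set[OF f r(2)])
  have clg: "closed (P g n)" for n unfolding P_def by (rule closed_stay_set[OF g r(3)])
  have Asub: "A h n \<subseteq> P h n" for h n unfolding A_def by (rule connected_component_subset)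
  have Pball: "P h n \<subseteq> cball 0 r" for h n
  proof
    fix p assume "p \<in> P h n"
    then have "(h ^^ 0) p \<in> cball 0 r" unfolding P_def by blast
    then show "p \<in> cball 0 r" by simp
  qed
  have A0: "0 \<in> A h n" if "h 0 = 0" for h n using P0[of h, OF that] by (simp add: A_def)
  have Acomp: "compact (A h n)" if "closed (P h n)" for h n
  proof -
    have "closed (A h n)" unfolding A_def using that by (rule closed_connected_component)
    then show ?thesis using Asub Pball by (metis bounded_cball bounded_subset compact_eq_bounded_closed)
  qed
  have touch: "\<exists>K. compact K \<and> connected K \<and> 0 \<in> K \<and> K \<inter> sphere 0 r \<noteq> {} \<and> K \<subseteq> {p. \<forall>j. (h ^^ j) p \<in> cball 0 r}"
    if h: "h 0 = 0" "\<And>n. closed (P h n)" "\<And>n. A h n \<inter> sphere 0 r \<noteq> {}" for h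
  proof (intro exI conjI)
    have mono: "A h n \<subseteq> A h m" if "m \<le> n" for m n
      unfolding A_def using Pmono[OF that] by (rule connected_component_mono)
    let ?K = "\<Inter>(range (A h))"
    show "compact ?K" using Acomp[OF h(2)] by (intro compact_Inter) auto
    show "connected ?K" using Acomp[OF h(2)] mono by (intro connected_nest) (auto simp: A_def)
    show "0 \<in> ?K" using A0[of h, OF h(1)] by simp
    have "\<Inter>(range (\<lambda>n. A h n \<inter> sphere 0 r)) \<noteq> {}"
      using Acomp[OF h(2)] mono h(3) by (intro compact_nest) (auto intro!: compact_Int_closed)
    then show "?K \<inter> sphere 0 r \<noteq> {}" by auto
    have "(h ^^ j) p \<in> cball 0 r" if "p \<in> ?K" for p j
      using that Asub[of h j] unfolding P_def by blast
    then show "?K \<subseteq> {p. \<forall>j. (h ^^ j) p \<in> cball 0 r}" by blast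
  qed
  have "(\<forall>n. A f n \<inter> sphere 0 r \<noteq> {}) \<or> (\<forall>n. A g n \<inter> sphere 0 r \<noteq> {})"
  proof (rule ccontr)
    assume "\<not> ?thesis"
    then obtain n1 n2 where n12: "A f n1 \<inter> sphere 0 r = {}" "A g n2 \<inter> sphere 0 r = {}" by blast
    define n where "n = max n1 n2"
    have An: "A f n \<inter> sphere 0 r = {}" "A g n \<inter> sphere 0 r = {}"
      using n12 connected_component_mono[OF Pmono, of n1 n f 0] connected_component_mono[OF Pmono, of n2 n g 0]
      by (auto simp: A_def n_def)
    let ?A = "A f (2*n)"
    have inP: "(f ^^ j) p \<in> cball 0 r" if "p \<in> ?A" "j \<le> 2*n" for p j
      using that Asub[of f "2*n"] by (auto simp: P_def)
    have ball: "(f ^^ k) p \<in> ball 0 r" if p: "p \<in> ?A" and k: "k \<le> 2*n" for p k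
    proof -
      have "continuous_on ?A (f ^^ k)"
        using inP k r(2) by (intro continuous_on_funpow_stay[OF f(2)]) force
      then have conn: "connected ((f ^^ k) ` ?A)"
        by (rule connected_continuous_image) (simp add: A_def)
      have 0: "0 \<in> (f ^^ k) ` ?A" using A0[of f, OF f0] zero[of f, OF f0] by (metis image_eqI)
      \<comment> \<open>The reason for \<open>2*n\<close> steps: at time \<open>k\<close> either
        \<open>n\<close> further forward steps or \<open>n\<close> backward steps stay in the ball.
        So the image, connected and containing 0, lies in one of two components that both miss the
        sphere.\<close>
      have "(f ^^ k) ` ?A \<subseteq> A f n \<or> (f ^^ k) ` ?A \<subseteq> A g n"
      proof (cases "k \<le> n")
        case True
        have "(f ^^ j) ((f ^^ k) q) \<in> cball 0 r" if "q \<in> ?A" "j \<le> n" for q j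
          using inP[OF that(1), of "j + k"] that(2) True by (simp add: funpow_add)
        then have "(f ^^ k) ` ?A \<subseteq> P f n" by (auto simp: P_def)
        then show ?thesis unfolding A_def using conn 0 by (simp add: A_def connected_component_maximal)
      next
        case False
        have "(g ^^ j) ((f ^^ k) q) \<in> cball 0 r" if "q \<in> ?A" "j \<le> n" for q j
        proof -
          have "(g ^^ j) ((f ^^ k) q) = (f ^^ (k - j)) q"
            using inP[OF that(1)] k r(2) False that(2)
            by (intro funpow_inverse_cancel[where W = U]) (auto intro!: fg simp: subset_iff)
          then show ?thesis using inP[OF that(1), of "k - j"] k by simp
        qed
        then have "(f ^^ k) ` ?A \<subseteq> P g n" by (auto simp: P_def)
        then show ?thesis unfolding A_def using conn 0 by (simp add: A_def connected_component_maximal)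
      qed
      then have "(f ^^ k) p \<notin> sphere 0 r" using An p by blast
      then show ?thesis using inP[OF p k] by auto
    qed
    define W where "W = {p. \<forall>j\<le>2*n. (f ^^ j) p \<in> ball 0 r}"
    have "open W" unfolding W_def
      using r(2) by (intro open_stay_set[OF f(2)]) (auto simp: subset_iff)
    have "?A \<subseteq> W" using ball by (auto simp: W_def)
    moreover have "W \<subseteq> P f (2*n)" by (auto simp: W_def P_def less_imp_le)
    moreover have "connected ?A" "0 \<in> ?A" using A0[of f, OF f0] by (auto simp: A_def)
    ultimately have "?A = connected_component_set W 0"
      by (metis A_def connected_component_maximal connected_component_mono subset_antisym)
    then have "open ?A" using \<open>open W\<close> by (simp add: open_connected_component)
    moreover have "closed ?A" using Acomp[OF clf] by (rule compact_imp_closed)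
    ultimately have "?A = UNIV" using \<open>0 \<in> ?A\<close> clopen[of ?A] by auto
    then show False using Acomp[OF clf, of "2*n"] not_bounded_UNIV compact_imp_bounded by metis
  qed
  then show thesis using touch[OF f0 clf] touch[OF g0 clg] that by metis
qed

section \<open>Two-by-two complex matrices\<close>

definition matpow :: "complex^2^2 \<Rightarrow> nat \<Rightarrow> complex^2^2" where
  "matpow J n = ((**) J ^^ n) (mat 1)"

lemma matpow_simps [simp]: "matpow J 0 = mat 1" "matpow J (Suc n) = J ** matpow J n"
  by (simp_all add: matpow_def)

text \<open>The matrix \<alpha> I + \<beta> J. By Cayley-Hamilton every polynomial in
  \<open>J\<close> has this form, and its eigenvalues are \<alpha> + \<beta> a and \<alpha> +
  \<beta> b, so no normal form of \<open>J\<close> is needed.\<close>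

definition affine_matrix :: "complex^2^2 \<Rightarrow> complex \<Rightarrow> complex \<Rightarrow> complex^2^2" where
  "affine_matrix J \<alpha> \<beta> = (\<chi> i j. (if i = j then \<alpha> else 0) + \<beta> * J $ i $ j)"

lemma affine_matrix_add:
  "affine_matrix J \<alpha> \<beta> + affine_matrix J \<alpha>' \<beta>' = affine_matrix J (\<alpha> + \<alpha>') (\<beta> + \<beta>')"
  by (simp add: affine_matrix_def vec_eq_iff algebra_simps)

text \<open>This is Cayley-Hamilton, J^2 = (a + b) J - a b I, in the form needed for
  recursion.\<close>

lemma mult_affine_matrix:
  assumes "trace J = a + b" "det J = a * b"
  shows "J ** affine_matrix J \<alpha> \<beta> = affine_matrix J (- a * b * \<beta>) (\<alpha> + \<beta> * (a + b))"
proof -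
  have t: "J$2$2 = a + b - J$1$1" using assms(1) by (simp add: trace_def sum_2 algebra_simps)
  have "J$1$2 * J$2$1 = J$1$1 * J$2$2 - a * b"
    using assms(2) unfolding det_2 by (metis add_diff_cancel_left' diff_add_cancel)
  then have d: "J$1$2 * J$2$1 = J$1$1 * (a + b - J$1$1) - a * b" unfolding t .
  show ?thesis
    unfolding affine_matrix_def matrix_matrix_mult_def vec_eq_iff forall_2
    using arg_cong[OF d, of "(*) \<beta>"] by (auto simp: sum_2 t algebra_simps)
qed

lemma trace_affine_matrix:
  "trace J = a + b \<Longrightarrow> trace (affine_matrix J \<alpha> \<beta>) = (\<alpha> + \<beta> * a) + (\<alpha> + \<beta> * b)"
proof -
  assume "trace J = a + b"
  then have "J$1$1 + J$2$2 = a + b" by (simp add: trace_def sum_2)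
  moreover have "trace (affine_matrix J \<alpha> \<beta>) = \<alpha> + \<alpha> + \<beta> * (J$1$1 + J$2$2)"
    by (simp add: trace_def affine_matrix_def sum_2 algebra_simps)
  ultimately show ?thesis by (simp add: algebra_simps)
qed

lemma det_affine_matrix:
  assumes "trace J = a + b" "det J = a * b"
  shows "det (affine_matrix J \<alpha> \<beta>) = (\<alpha> + \<beta> * a) * (\<alpha> + \<beta> * b)"
proof -
  have t: "J$2$2 = a + b - J$1$1" using assms(1) by (simp add: trace_def sum_2 algebra_simps)
  have "J$1$2 * J$2$1 = J$1$1 * J$2$2 - a * b"
    using assms(2) unfolding det_2 by (metis add_diff_cancel_left' diff_add_cancel)
  then have d: "J$1$2 * J$2$1 = J$1$1 * (a + b - J$1$1) - a * b" unfolding t .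
  have "det (affine_matrix J \<alpha> \<beta>)
      = (\<alpha> + \<beta> * J$1$1) * (\<alpha> + \<beta> * (a + b - J$1$1)) - \<beta>\<^sup>2 * (J$1$2 * J$2$1)"
    by (simp add: det_2 affine_matrix_def t power2_eq_square algebra_simps)
  also have "\<dots> = (\<alpha> + \<beta> * a) * (\<alpha> + \<beta> * b)"
    unfolding d by (simp add: power2_eq_square algebra_simps)
  finally show ?thesis .
qed

text \<open>One linear polynomial represents the power of the matrix and takes the values of the
  power at both eigenvalues; the recursion also covers a = b, where interpolation alone would not
  determine it.\<close>

lemma matpow_affine:
  assumes "trace J = a + b" "det J = a * b"
  obtains \<alpha> \<beta> where "matpow J n = affine_matrix J \<alpha> \<beta>" "a ^ n = \<alpha> + \<beta> * a" "b ^ n = \<alpha> + \<beta> * b"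
proof -
  have "\<exists>\<alpha> \<beta>. matpow J n = affine_matrix J \<alpha> \<beta> \<and> a ^ n = \<alpha> + \<beta> * a \<and> b ^ n = \<alpha> + \<beta> * b"
  proof (induction n)
    case 0
    have "matpow J 0 = affine_matrix J 1 0" by (simp add: affine_matrix_def mat_def)
    then show ?case by (metis add.right_neutral mult_zero_left power_0)
  next
    case (Suc n)
    then obtain \<alpha> \<beta> where *: "matpow J n = affine_matrix J \<alpha> \<beta>" "a ^ n = \<alpha> + \<beta> * a" "b ^ n = \<alpha> + \<beta> * b"
      by blast
    show ?case
      by (intro exI[of _ "- a * b * \<beta>"] exI[of _ "\<alpha> + \<beta> * (a + b)"])
         (simp add: * mult_affine_matrix[OF assms] algebra_simps)
  qed
  then show thesis using that by blast
qed

lemma trace_det_matpow: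
  assumes "trace J = a + b" "det J = a * b"
  shows "trace (matpow J n) = a ^ n + b ^ n" "det (matpow J n) = a ^ n * b ^ n"
  using matpow_affine[OF assms, of n] trace_affine_matrix[OF assms(1)] det_affine_matrix[OF assms]
  by metis+

text \<open>The matrix I + J + ... + J^(n-1) is the cofactor of J - I in J^n - I; its invertibility
  will rule out new fixed points of the n-th iterate.\<close>

lemma det_sum_matpow:
  assumes "trace J = a + b" "det J = a * b"
  shows "det (\<Sum>i<n. matpow J i) = (\<Sum>i<n. a ^ i) * (\<Sum>i<n. b ^ i)"
proof -
  have "\<exists>\<alpha> \<beta>. (\<Sum>i<n. matpow J i) = affine_matrix J \<alpha> \<beta> \<and> (\<Sum>i<n. a ^ i) = \<alpha> + \<beta> * a
          \<and> (\<Sum>i<n. b ^ i) = \<alpha> + \<beta> * b"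
  proof (induction n)
    case 0
    have "affine_matrix J 0 0 = 0" by (simp add: affine_matrix_def vec_eq_iff)
    then show ?case by (intro exI[of _ 0]) simp
  next
    case (Suc n)
    then obtain \<alpha> \<beta> where "(\<Sum>i<n. matpow J i) = affine_matrix J \<alpha> \<beta>"
      "(\<Sum>i<n. a ^ i) = \<alpha> + \<beta> * a" "(\<Sum>i<n. b ^ i) = \<alpha> + \<beta> * b" by blast
    moreover obtain \<alpha>' \<beta>' where "matpow J n = affine_matrix J \<alpha>' \<beta>'" "a ^ n = \<alpha>' + \<beta>' * a" "b ^ n = \<alpha>' + \<beta>' * b"
      using matpow_affine[OF assms] .
    ultimately show ?case
      by (intro exI[of _ "\<alpha> + \<alpha>'"] exI[of _ "\<beta> + \<beta>'"]) (simp add: affine_matrix_add algebra_simps)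
  qed
  then show ?thesis using det_affine_matrix[OF assms] by metis
qed

lemma eigenvalues_2x2:
  fixes J :: "complex^2^2"
  obtains a b where "trace J = a + b" "det J = a * b"
proof -
  let ?s = "csqrt ((trace J)\<^sup>2 - 4 * det J)"
  have "((trace J + ?s) / 2) * ((trace J - ?s) / 2) = ((trace J)\<^sup>2 - ?s\<^sup>2) / 4"
    by (simp add: power2_eq_square field_simps)
  also have "\<dots> = det J" by simp
  finally show thesis by (intro that[of "(trace J + ?s) / 2" "(trace J - ?s) / 2"]) (simp_all add: field_simps)
qed

text \<open>The pair stands for (trace, determinant), so the quadratic is the characteristic
  polynomial. Unlike a choice of eigenvalues, these coefficients depend continuously on the
  matrix.\<close>

definition unity_free :: "complex \<times> complex \<Rightarrow> bool" where
  "unity_free c \<longleftrightarrow> (\<forall>z n. z\<^sup>2 - fst c * z + snd c = 0 \<longrightarrow> n > 0 \<longrightarrow> z ^ n = 1 \<longrightarrow> z = 1)"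

definition spec :: "complex^2^2 \<Rightarrow> complex \<times> complex" where
  "spec J = (trace J, det J)"

lemma unity_free_iff:
  "unity_free (a + b, a * b) \<longleftrightarrow> (\<forall>n>0. (a ^ n = 1 \<longrightarrow> a = 1) \<and> (b ^ n = 1 \<longrightarrow> b = 1))"
proof -
  have "z\<^sup>2 - (a + b) * z + a * b = (z - a) * (z - b)" for z
    by (simp add: power2_eq_square algebra_simps)
  then show ?thesis by (auto simp: unity_free_def)
qed

lemma spec_matpow:
  assumes "spec J = (a + b, a * b)"
  shows "spec (matpow J n) = (a ^ n + b ^ n, a ^ n * b ^ n)"
  using trace_det_matpow[of J a b n] assms by (simp add: spec_def)

lemma spec_cases:
  obtains a b where "spec J = (a + b, a * b)"
  using eigenvalues_2x2[of J] by (metis spec_def)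

lemma unity_free_sum_nonzero:
  fixes a :: complex
  assumes "\<forall>n>0. a ^ n = 1 \<longrightarrow> a = 1" "n > 0"
  shows "(\<Sum>i<n. a ^ i) \<noteq> 0"
proof (cases "a = 1")
  case False
  have "(\<Sum>i<n. a ^ i) = (a ^ n - 1) / (a - 1)" using False by (rule geometric_sum)
  then show ?thesis using False assms by auto
qed (use assms in auto)

lemma det_sum_matpow_nonzero:
  assumes "unity_free (spec J)" "n > 0"
  shows "det (\<Sum>i<n. matpow J i) \<noteq> 0"
proof -
  obtain a b where ab: "spec J = (a + b, a * b)" by (rule spec_cases)
  then show ?thesis
    using assms unity_free_sum_nonzero[of a n] unity_free_sum_nonzero[of b n] det_sum_matpow[of J a b n]
    by (auto simp: unity_free_iff spec_def)
qed

lemma unity_free_matpow: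
  assumes "unity_free (spec J)" "l > 0"
  shows "unity_free (spec (matpow J l))"
proof -
  obtain a b where ab: "spec J = (a + b, a * b)" by (rule spec_cases)
  have "(z ^ l) ^ n = 1 \<longrightarrow> z ^ l = 1" if "\<forall>n>0. z ^ n = 1 \<longrightarrow> z = 1" "n > 0" for z :: complex and n
  proof
    assume "(z ^ l) ^ n = 1"
    then have "z ^ (l * n) = 1" by (simp add: power_mult)
    then have "z = 1" using that assms(2) by (metis nat_0_less_mult_iff)
    then show "z ^ l = 1" by simp
  qed
  then show ?thesis using assms(1) unfolding spec_matpow[OF ab] ab unity_free_iff by blast
qed

text \<open>The exceptional value (2, 1) means that both eigenvalues are 1.\<close>

lemma sum_prod_unipotent:
  fixes a b :: complex
  assumes "a + b = 2" "a * b = 1"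
  shows "a = 1" "b = 1"
proof -
  have "(a - 1)\<^sup>2 = a * (a + b) - a * b - 2 * a + 1" by (simp add: power2_eq_square algebra_simps)
  also have "\<dots> = 0" using assms by simp
  finally show "a = 1" by simp
  then show "b = 1" using assms by simp
qed

lemma spec_matpow_unipotent: "spec J = (2, 1) \<Longrightarrow> spec (matpow J l) = (2, 1)"
  using spec_matpow[of J 1 1 l] by simp

lemma unity_free_unipotent: "unity_free (2, 1)"
  using unity_free_iff[of 1 1] by simp

text \<open>Both eigenvalues of such a \<open>J\<close> are \<open>l\<close>-th roots of unity. This
  supplies the finite set \<open>Z\<close> required at the exceptional value.\<close>

lemma finite_spec_roots_of_unipotent:
  assumes "l > 0"
  shows "finite {spec J | J. spec (matpow J l) = (2, 1)}"
proof -
  let ?R = "{z::complex. z ^ l = 1}"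
  have "spec J \<in> (\<lambda>(a, b). (a + b, a * b)) ` (?R \<times> ?R)" if "spec (matpow J l) = (2, 1)" for J
  proof -
    obtain a b where ab: "spec J = (a + b, a * b)" by (rule spec_cases)
    then have "a ^ l = 1" "b ^ l = 1"
      using that sum_prod_unipotent[of "a ^ l" "b ^ l"] by (simp_all add: spec_matpow)
    then show ?thesis using ab by force
  qed
  then have "{spec J | J. spec (matpow J l) = (2, 1)} \<subseteq> (\<lambda>(a, b). (a + b, a * b)) ` (?R \<times> ?R)" by blast
  moreover have "finite ?R" using assms by (intro finite_nth_roots)
  ultimately show ?thesis by (meson finite_SigmaI finite_imageI finite_subset)
qed

text \<open>An eigenvalue that is a root of unity becomes 1 in some power; one that is not stays so
  in all positive powers. The product of the two exponents serves both eigenvalues, as do its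
  multiples.\<close>

lemma ex_unity_free_power:
  obtains n where "n > 0" "\<And>l. n dvd l \<Longrightarrow> l > 0 \<Longrightarrow> unity_free (spec (matpow J l))"
proof -
  obtain a b where ab: "spec J = (a + b, a * b)" by (rule spec_cases)
  have ord: "\<exists>n>0. \<forall>l. n dvd l \<longrightarrow> l > 0 \<longrightarrow> (\<forall>m>0. (z ^ l) ^ m = 1 \<longrightarrow> z ^ l = 1)" for z :: complex
  proof (cases "\<exists>n>0. z ^ n = 1")
    case True
    then show ?thesis by (metis dvd_def power_mult power_one)
  next
    case False
    then show ?thesis by (metis mult_pos_pos power_mult zero_less_one)
  qed
  obtain n1 where n1: "n1 > 0" "\<And>l m. n1 dvd l \<Longrightarrow> l > 0 \<Longrightarrow> m > 0 \<Longrightarrow> (a ^ l) ^ m = 1 \<Longrightarrow> a ^ l = 1"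
    using ord[of a] by blast
  obtain n2 where n2: "n2 > 0" "\<And>l m. n2 dvd l \<Longrightarrow> l > 0 \<Longrightarrow> m > 0 \<Longrightarrow> (b ^ l) ^ m = 1 \<Longrightarrow> b ^ l = 1"
    using ord[of b] by blast
  show thesis
  proof (rule that[of "n1 * n2"])
    show "n1 * n2 > 0" using n1 n2 by simp
    fix l assume "n1 * n2 dvd l" "l > 0"
    then show "unity_free (spec (matpow J l))"
      unfolding spec_matpow[OF ab] unity_free_iff
      using n1(2) n2(2) by (meson dvd_mult_left dvd_mult_right)
  qed
qed

section \<open>Holomorphic maps of two variables\<close>

lemma norm_scalar_mult_cart: "norm (c *s x) = norm c * norm (x :: complex^'n)"
  by (simp add: norm_vec_def L2_set_def norm_mult power_mult_distrib real_sqrt_mult flip: sum_distrib_left)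

lemma norm_axis_complex [simp]: "norm (axis j c :: complex^'n) = norm c"
proof -
  have "(\<Sum>i\<in>UNIV. (norm ((axis j c :: complex^'n) $ i))\<^sup>2) = (\<Sum>i\<in>UNIV. if i = j then (norm c)\<^sup>2 else 0)"
    by (intro sum.cong) (auto simp: axis_def)
  then show ?thesis by (simp add: norm_vec_def L2_set_def)
qed

lemma bounded_bilinear_matrix_vector_mult:
  "bounded_bilinear ((*v) :: complex^2^2 \<Rightarrow> complex^2 \<Rightarrow> complex^2)"
  unfolding bilinear_conv_bounded_bilinear[symmetric] bilinear_def
  by (auto intro!: linearI simp: matrix_vector_right_distrib matrix_vector_mult_add_rdistrib
      matrix_vector_mult_def vec_eq_iff scaleR_sum_right distrib_right sum.distrib)

lemma matrix_vector_mult_axis: "((A :: complex^2^2) *v axis j 1) $ i = A $ i $ j"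
proof -
  have "(\<Sum>k\<in>UNIV. A $ i $ k * (axis j 1 :: complex^2) $ k) = (\<Sum>k\<in>UNIV. if k = j then A $ i $ j else 0)"
    by (intro sum.cong) (auto simp: axis_def)
  then show ?thesis by (simp add: matrix_vector_mult_def)
qed

lemmas bounded_linear_matrix_vector_mult = bounded_bilinear.bounded_linear_right[OF bounded_bilinear_matrix_vector_mult]

definition jac :: "(complex^2 \<Rightarrow> complex^2) \<Rightarrow> complex^2 \<Rightarrow> complex^2^2" where
  "jac f p = matrix (frechet_derivative f (at p))"

lemma jac_eqI: "(f has_derivative (\<lambda>v. J *v v)) (at p) \<Longrightarrow> jac f p = J"
  by (simp add: jac_def flip: frechet_derivative_at)

lemma has_derivative_jac:
  "holomorphic_map_on f U \<Longrightarrow> p \<in> U \<Longrightarrow> (f has_derivative (\<lambda>v. jac f p *v v)) (at p)"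
  unfolding holomorphic_map_on_def using jac_eqI by metis

lemma holomorphic_map_on_subset: "holomorphic_map_on f U \<Longrightarrow> open W \<Longrightarrow> W \<subseteq> U \<Longrightarrow> holomorphic_map_on f W"
  by (auto simp: holomorphic_map_on_def)

text \<open>Restriction to a complex curve, one whose derivative is complex linear, gives access to
  one-variable theory for each coordinate.\<close>

lemma has_field_derivative_along_curve:
  assumes "(f has_derivative (\<lambda>v. J *v v)) (at (\<gamma> t))" "(\<gamma> has_derivative (\<lambda>s. s *s w)) (at t)"
  shows "((\<lambda>t. f (\<gamma> t) $ i) has_field_derivative (J *v w) $ i) (at t)"
proof -
  have "((\<lambda>t. f (\<gamma> t)) has_derivative (\<lambda>s. J *v (s *s w))) (at t)"
    using assms(2,1) by (rule has_derivative_compose)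
  then have "((\<lambda>t. f (\<gamma> t) $ i) has_derivative (\<lambda>s. (J *v (s *s w)) $ i)) (at t)"
    by (rule bounded_linear.has_derivative[OF bounded_linear_vec_nth])
  moreover have "(\<lambda>s. (J *v (s *s w)) $ i) = (*) ((J *v w) $ i)"
    by (simp add: vector_scalar_commute mult.commute fun_eq_iff)
  ultimately show ?thesis by (simp add: has_field_derivative_def)
qed

lemma has_derivative_line: "((\<lambda>t. p + t *s e) has_derivative (\<lambda>s. s *s (e :: complex^2))) (at t)"
proof -
  have "bounded_linear (\<lambda>s. s *s e)"
    by (rule bounded_linear_intro[where K = "norm e"])
       (auto simp: vec_eq_iff norm_scalar_mult_cart distrib_right)
  then have "((\<lambda>s. s *s e) has_derivative (\<lambda>s. s *s e)) (at t)"
    by (rule bounded_linear_imp_has_derivative)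
  from has_derivative_add[OF has_derivative_const this] show ?thesis by simp
qed

text \<open>Holomorphy is defined by pointwise differentiability, so continuity of the Jacobian
  comes from complex analysis: Cauchy's inequality, applied to the difference of \<open>f\<close>
  along two parallel complex lines, bounds the difference of the partial derivatives.\<close>

lemma continuous_on_jac:
  assumes f: "holomorphic_map_on f U"
  shows "continuous_on U (jac f)"
proof (rule continuous_at_imp_continuous_on, rule ballI)
  fix q assume q: "q \<in> U"
  have "open U" using f by (simp add: holomorphic_map_on_def)
  then obtain r where r: "r > 0" "cball q r \<subseteq> U" using q open_contains_cball by blast
  define \<rho> where "\<rho> = r / 2"
  have \<rho>: "\<rho> > 0" using r by (simp add: \<rho>_def)
  have "continuous_on (cball q r) f"
    using holomorphic_map_on_continuous[OF f] r(2) by (rule continuous_on_subset)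
  then have uc: "uniformly_continuous_on (cball q r) f"
    by (rule compact_uniformly_continuous) simp
  have "((\<lambda>p. jac f p $ i $ j) \<longlongrightarrow> jac f q $ i $ j) (at q)" for i j
  proof (rule tendstoI)
    fix \<epsilon> :: real assume \<epsilon>: "\<epsilon> > 0"
    \<comment> \<open>Cauchy's inequality divides this bound by \<open>\<rho>\<close>, which leaves
      \<epsilon> / 2.\<close>
    have "\<epsilon> * \<rho> / 2 > 0" using \<epsilon> \<rho> by simp
    with uc obtain \<delta> where \<delta>: "\<delta> > 0"
      "\<And>x y. x \<in> cball q r \<Longrightarrow> y \<in> cball q r \<Longrightarrow> dist y x < \<delta> \<Longrightarrow> dist (f y) (f x) < \<epsilon> * \<rho> / 2"
      unfolding uniformly_continuous_on_def by metis
    have "dist (jac f p $ i $ j) (jac f q $ i $ j) < \<epsilon>" if p: "dist p q < min \<delta> \<rho>" for p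
    proof -
      let ?e = "axis j 1 :: complex^2"
      define u where "u = (\<lambda>\<zeta>. f (p + \<zeta> *s ?e) $ i - f (q + \<zeta> *s ?e) $ i)"
      have in_cball: "p + \<zeta> *s ?e \<in> cball q r" "q + \<zeta> *s ?e \<in> cball q r" if "norm \<zeta> \<le> \<rho>" for \<zeta>
      proof -
        have "norm (p + \<zeta> *s ?e - q) \<le> norm (p - q) + norm (\<zeta> *s ?e)"
          by (metis add_diff_eq add.commute norm_triangle_ineq diff_add_eq)
        also have "\<dots> \<le> r" using that p by (simp add: norm_scalar_mult_cart \<rho>_def dist_norm)
        finally show "p + \<zeta> *s ?e \<in> cball q r" by (simp add: dist_norm norm_minus_commute)
        show "q + \<zeta> *s ?e \<in> cball q r"
          using that r(1) by (simp add: dist_norm norm_scalar_mult_cart \<rho>_def)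
      qed
      have du: "(u has_field_derivative
          ((jac f (p + \<zeta> *s ?e) *v ?e) $ i - (jac f (q + \<zeta> *s ?e) *v ?e) $ i)) (at \<zeta>)"
        if "norm \<zeta> \<le> \<rho>" for \<zeta>
        unfolding u_def using in_cball[OF that] r(2)
        by (intro DERIV_diff has_field_derivative_along_curve[OF has_derivative_jac[OF f] has_derivative_line]) auto
      have "norm ((deriv ^^ 1) u 0) \<le> fact 1 * (\<epsilon> * \<rho> / 2) / \<rho> ^ 1"
      proof (rule Cauchy_inequality)
        show "u holomorphic_on ball 0 \<rho>"
          unfolding holomorphic_on_def
        proof
          fix \<zeta> assume "\<zeta> \<in> ball (0::complex) \<rho>"
          then have "u field_differentiable at \<zeta>"
            unfolding field_differentiable_def using du[of \<zeta>] by (metis dist_0_norm less_imp_le mem_ball)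
          then show "u field_differentiable at \<zeta> within ball 0 \<rho>" by (rule field_differentiable_at_within)
        qed
        show "continuous_on (cball 0 \<rho>) u"
          using du by (intro continuous_at_imp_continuous_on ballI) (auto intro: DERIV_isCont)
        show "\<rho> > 0" by (rule \<rho>)
        fix \<zeta> assume "cmod (0 - \<zeta>) = \<rho>"
        then have *: "p + \<zeta> *s ?e \<in> cball q r" "q + \<zeta> *s ?e \<in> cball q r" using in_cball by auto
        have "norm (u \<zeta>) = norm ((f (p + \<zeta> *s ?e) - f (q + \<zeta> *s ?e)) $ i)" by (simp add: u_def)
        also have "\<dots> \<le> norm (f (p + \<zeta> *s ?e) - f (q + \<zeta> *s ?e))" by (rule Finite_Cartesian_Product.norm_nth_le)
        also have "\<dots> < \<epsilon> * \<rho> / 2" using \<delta>(2)[OF *(2,1)] p by (simp add: dist_norm)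
        finally show "norm (u \<zeta>) \<le> \<epsilon> * \<rho> / 2" by simp
      qed
      moreover have "deriv u 0 = jac f p $ i $ j - jac f q $ i $ j"
        using DERIV_imp_deriv[OF du[of 0]] \<rho> by (simp add: matrix_vector_mult_axis)
      ultimately show ?thesis using \<epsilon> \<rho> by (simp add: dist_norm)
    qed
    then show "\<forall>\<^sub>F p in at q. dist (jac f p $ i $ j) (jac f q $ i $ j) < \<epsilon>"
      unfolding eventually_at using \<delta>(1) \<rho> by (intro exI[of _ "min \<delta> \<rho>"]) auto
  qed
  then show "isCont (jac f) q"
    unfolding isCont_def by (intro vec_tendstoI)
qed

text \<open>Mean value inequality for \<open>f\<close> minus its linear part at \<open>p\<close>.
  Uniform continuity of the Jacobian on the doubled ball makes \<delta> independent of
  \<open>p\<close>.\<close>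

lemma uniform_strict_derivative:
  assumes f: "holomorphic_map_on f U" and r: "cball q (2 * r) \<subseteq> U" "r > 0" and \<epsilon>: "\<epsilon> > 0"
  obtains \<delta> where "\<delta> > 0" "\<delta> \<le> r"
    "\<And>p x y. p \<in> cball q r \<Longrightarrow> x \<in> ball p \<delta> \<Longrightarrow> y \<in> ball p \<delta> \<Longrightarrow>
       norm (f x - f y - jac f p *v (x - y)) \<le> \<epsilon> * norm (x - y)"
proof -
  obtain K where K: "K > 0" "\<And>A v. norm ((A :: complex^2^2) *v v) \<le> norm A * norm v * K"
    using bounded_bilinear.pos_bounded[OF bounded_bilinear_matrix_vector_mult] by blast
  have "uniformly_continuous_on (cball q (2 * r)) (jac f)"
    using continuous_on_subset[OF continuous_on_jac[OF f] r(1)] by (rule compact_uniformly_continuous) simp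
  moreover have "\<epsilon> / K > 0" using \<epsilon> K by simp
  ultimately obtain \<delta>' where \<delta>': "\<delta>' > 0" "\<And>x y. x \<in> cball q (2 * r) \<Longrightarrow> y \<in> cball q (2 * r) \<Longrightarrow> dist y x < \<delta>'
      \<Longrightarrow> dist (jac f y) (jac f x) < \<epsilon> / K"
    unfolding uniformly_continuous_on_def by metis
  show thesis
  proof (rule that[of "min \<delta>' r"])
    fix p x y assume p: "p \<in> cball q r" and xy: "x \<in> ball p (min \<delta>' r)" "y \<in> ball p (min \<delta>' r)"
    have sub: "z \<in> cball q (2 * r)" if "z \<in> ball p (min \<delta>' r)" for z
      using that p dist_triangle[of q z p] by simp
    let ?g = "\<lambda>x. f x - jac f p *v x"
    have "norm (?g x - ?g y) \<le> \<epsilon> * norm (x - y)"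
    proof (rule differentiable_bound[where S = "ball p (min \<delta>' r)" and f' = "\<lambda>z v. jac f z *v v - jac f p *v v"])
      fix z assume z: "z \<in> ball p (min \<delta>' r)"
      show "(?g has_derivative (\<lambda>v. jac f z *v v - jac f p *v v)) (at z within ball p (min \<delta>' r))"
        using sub[OF z] r(1)
        by (intro has_derivative_diff has_derivative_at_withinI[OF has_derivative_jac[OF f]]
            bounded_linear_imp_has_derivative bounded_linear_matrix_vector_mult) auto
      show "onorm (\<lambda>v. jac f z *v v - jac f p *v v) \<le> \<epsilon>"
      proof (rule onorm_le)
        fix v
        have "norm (jac f z *v v - jac f p *v v) = norm ((jac f z - jac f p) *v v)"
          by (simp add: matrix_vector_mult_diff_rdistrib)
        also have "\<dots> \<le> norm (jac f z - jac f p) * norm v * K" by (rule K)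
        also have "\<dots> \<le> (\<epsilon> / K) * norm v * K"
          using \<delta>'(2)[of p z] sub[OF z] sub[of p] z K(1) r(2) \<delta>'(1)
          by (intro mult_right_mono) (auto simp: dist_norm norm_minus_commute)
        finally show "norm (jac f z *v v - jac f p *v v) \<le> \<epsilon> * norm v" using K by simp
      qed
    qed (use xy in auto)
    then show "norm (f x - f y - jac f p *v (x - y)) \<le> \<epsilon> * norm (x - y)"
      by (simp add: matrix_vector_mult_diff_distrib algebra_simps)
  qed (use \<delta>' r in auto)
qed

lemma strict_derivative:
  assumes f: "holomorphic_map_on f U" and q: "q \<in> U" and \<epsilon>: "\<epsilon> > 0"
  shows "\<exists>\<delta>>0. ball q \<delta> \<subseteq> U \<and>
    (\<forall>x\<in>ball q \<delta>. \<forall>y\<in>ball q \<delta>. norm (f x - f y - jac f q *v (x - y)) \<le> \<epsilon> * norm (x - y))"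
proof -
  have "open U" using f by (simp add: holomorphic_map_on_def)
  then obtain r where r: "r > 0" "cball q r \<subseteq> U" using q open_contains_cball by blast
  obtain \<delta> where \<delta>: "\<delta> > 0" "\<delta> \<le> r / 2" "\<And>p x y. p \<in> cball q (r / 2) \<Longrightarrow> x \<in> ball p \<delta> \<Longrightarrow> y \<in> ball p \<delta> \<Longrightarrow>
       norm (f x - f y - jac f p *v (x - y)) \<le> \<epsilon> * norm (x - y)"
    by (rule uniform_strict_derivative[OF f, of q "r / 2" \<epsilon>]) (use r \<epsilon> in auto)
  show ?thesis
    using \<delta> r by (intro exI[of _ \<delta>]) (auto simp: subset_iff)
qed

text \<open>Along the curve, a Jacobian entry is a locally uniform limit of difference quotients of
  \<open>f\<close> with fixed step, each holomorphic in the parameter. Second derivatives of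
  \<open>f\<close> do not enter.\<close>

lemma holomorphic_jac_along_curve:
  assumes f: "holomorphic_map_on f U" and D: "open D"
    and \<gamma>: "\<And>t. t \<in> D \<Longrightarrow> \<gamma> t \<in> U" "continuous_on D \<gamma>"
    and d\<gamma>: "\<And>t. t \<in> D \<Longrightarrow> \<exists>w. (\<gamma> has_derivative (\<lambda>s. s *s w)) (at t)"
  shows "(\<lambda>t. jac f (\<gamma> t) $ i $ j) holomorphic_on D"
  unfolding holomorphic_on_def
proof
  fix t0 assume t0: "t0 \<in> D"
  have "open U" using f by (simp add: holomorphic_map_on_def)
  then obtain r' where r': "r' > 0" "cball (\<gamma> t0) r' \<subseteq> U" using \<gamma>(1)[OF t0] open_contains_cball by blast
  define r where "r = r' / 2"
  have r: "r > 0" "cball (\<gamma> t0) (2 * r) \<subseteq> U" using r' by (auto simp: r_def)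
  have "open (D \<inter> \<gamma> -` ball (\<gamma> t0) r)"
    using \<gamma>(2) D by (intro continuous_open_preimage) auto
  then obtain \<rho> where \<rho>: "\<rho> > 0" "ball t0 \<rho> \<subseteq> D \<inter> \<gamma> -` ball (\<gamma> t0) r"
    using t0 r(1) by (metis IntI centre_in_ball open_contains_ball vimageI)
  let ?e = "axis j 1 :: complex^2"
  define \<zeta> where "\<zeta> = (\<lambda>n. complex_of_real (r / real (Suc n)))"
  have \<zeta>: "\<zeta> n \<noteq> 0" "norm (\<zeta> n) = r / real (Suc n)" "norm (\<zeta> n) \<le> r" for n
    using r(1) by (auto simp: \<zeta>_def field_simps norm_divide simp del: of_nat_Suc)
  have \<zeta>_lim: "(\<lambda>n. norm (\<zeta> n)) \<longlonglongrightarrow> 0"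
    unfolding \<zeta>(2) by (rule LIMSEQ_Suc[OF lim_const_over_n])
  define F where "F = (\<lambda>n t. (f (\<gamma> t + \<zeta> n *s ?e) $ i - f (\<gamma> t) $ i) / \<zeta> n)"
  have inU: "\<gamma> t \<in> U" "\<gamma> t + \<zeta> n *s ?e \<in> U" if "t \<in> ball t0 \<rho>" for t n
  proof -
    have 1: "dist (\<gamma> t0) (\<gamma> t) < r" using that \<rho>(2) by auto
    then show "\<gamma> t \<in> U" using that \<rho>(2) \<gamma>(1) by auto
    have "dist (\<gamma> t) (\<gamma> t + \<zeta> n *s ?e) \<le> r" using \<zeta>(3)[of n] by (simp add: dist_norm norm_scalar_mult_cart)
    then have "\<gamma> t + \<zeta> n *s ?e \<in> cball (\<gamma> t0) (2 * r)"
      using 1 dist_triangle[of "\<gamma> t0" "\<gamma> t + \<zeta> n *s ?e" "\<gamma> t"] by simp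
    then show "\<gamma> t + \<zeta> n *s ?e \<in> U" using r(2) by blast
  qed
  have "(\<lambda>t. jac f (\<gamma> t) $ i $ j) holomorphic_on ball t0 \<rho>"
  proof (rule holomorphic_uniform_sequence[where f = F])
    fix n
    have "F n field_differentiable (at t)" if t: "t \<in> ball t0 \<rho>" for t
    proof -
      obtain w where w: "(\<gamma> has_derivative (\<lambda>s. s *s w)) (at t)" using d\<gamma> t \<rho>(2) by blast
      then have w': "((\<lambda>t. \<gamma> t + \<zeta> n *s ?e) has_derivative (\<lambda>s. s *s w)) (at t)"
        using has_derivative_add[OF w has_derivative_const] by simp
      show ?thesis
        unfolding field_differentiable_def F_def
        using DERIV_cdivide[OF DERIV_diff[OF
            has_field_derivative_along_curve[OF has_derivative_jac[OF f inU(2)[OF t, of n]] w']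
            has_field_derivative_along_curve[OF has_derivative_jac[OF f inU(1)[OF t]] w]]]
        by blast
    qed
    then show "F n holomorphic_on ball t0 \<rho>"
      unfolding holomorphic_on_def by (meson field_differentiable_at_within)
  next
    fix t assume t: "t \<in> ball t0 \<rho>"
    then obtain d where d: "d > 0" "cball t d \<subseteq> ball t0 \<rho>" by (meson open_ball open_contains_cball)
    have "uniform_limit (cball t d) F (\<lambda>t. jac f (\<gamma> t) $ i $ j) sequentially"
    proof (rule uniform_limitI)
      fix \<epsilon> :: real assume \<epsilon>: "\<epsilon> > 0"
      then have \<epsilon>2: "\<epsilon> / 2 > 0" by simp
      obtain \<delta> where \<delta>: "\<delta> > 0" "\<And>p x y. p \<in> cball (\<gamma> t0) r \<Longrightarrow> x \<in> ball p \<delta> \<Longrightarrow> y \<in> ball p \<delta> \<Longrightarrow>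
         norm (f x - f y - jac f p *v (x - y)) \<le> (\<epsilon> / 2) * norm (x - y)"
        by (rule uniform_strict_derivative[OF f r(2,1) \<epsilon>2]) (rule that; assumption)
      have "\<forall>\<^sub>F n in sequentially. norm (\<zeta> n) < \<delta>" using \<zeta>_lim \<delta>(1) by (rule order_tendstoD)
      then show "\<forall>\<^sub>F n in sequentially. \<forall>s\<in>cball t d. dist (F n s) (jac f (\<gamma> s) $ i $ j) < \<epsilon>"
      proof (rule eventually_mono, intro ballI)
        fix n s assume n: "norm (\<zeta> n) < \<delta>" and s: "s \<in> cball t d"
        let ?R = "f (\<gamma> s + \<zeta> n *s ?e) - f (\<gamma> s) - jac f (\<gamma> s) *v (\<zeta> n *s ?e)"
        have "\<gamma> s \<in> cball (\<gamma> t0) r" using s d(2) \<rho>(2) by (force simp: subset_iff)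
        then have "norm ?R \<le> (\<epsilon> / 2) * norm (\<zeta> n)"
          using \<delta>(2)[of "\<gamma> s" "\<gamma> s + \<zeta> n *s ?e" "\<gamma> s"] \<delta>(1) n
          by (simp add: dist_norm norm_scalar_mult_cart)
        then have R: "norm (?R $ i) \<le> (\<epsilon> / 2) * norm (\<zeta> n)"
          using Finite_Cartesian_Product.norm_nth_le[of ?R i] by linarith
        have "?R $ i = \<zeta> n * (F n s - jac f (\<gamma> s) $ i $ j)"
          using \<zeta>(1)[of n] by (simp add: F_def vector_scalar_commute matrix_vector_mult_axis field_simps)
        then have "norm (F n s - jac f (\<gamma> s) $ i $ j) \<le> \<epsilon> / 2"
          using R \<zeta>(1)[of n] by (simp add: norm_mult mult.commute)
        then show "dist (F n s) (jac f (\<gamma> s) $ i $ j) < \<epsilon>" using \<epsilon> by (simp add: dist_norm)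
      qed
    qed
    then show "\<exists>d>0. cball t d \<subseteq> ball t0 \<rho> \<and> uniform_limit (cball t d) F (\<lambda>t. jac f (\<gamma> t) $ i $ j) sequentially"
      using d by blast
  qed simp
  then have "(\<lambda>t. jac f (\<gamma> t) $ i $ j) field_differentiable at t0"
    using \<rho>(1) by (intro holomorphic_on_imp_differentiable_at[of _ "ball t0 \<rho>"]) auto
  then show "(\<lambda>t. jac f (\<gamma> t) $ i $ j) field_differentiable at t0 within D"
    by (rule field_differentiable_at_within)
qed

lemma jac_compose:
  assumes "holomorphic_map_on f U" "p \<in> U" "holomorphic_map_on g V" "f p \<in> V"
  shows "jac (g \<circ> f) p = jac g (f p) ** jac f p"
proof (rule jac_eqI)
  have "(g \<circ> f has_derivative (\<lambda>v. jac g (f p) *v v) \<circ> (\<lambda>v. jac f p *v v)) (at p)"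
    using has_derivative_jac[OF assms(1,2)] has_derivative_jac[OF assms(3,4)] by (rule diff_chain_at)
  then show "(g \<circ> f has_derivative (\<lambda>v. (jac g (f p) ** jac f p) *v v)) (at p)"
    by (simp add: o_def matrix_vector_mul_assoc)
qed

lemma holomorphic_map_on_id: "holomorphic_map_on id UNIV"
  using local_biholomorphism_id by (simp add: local_biholomorphism_def biholomorphism_def)

lemma jac_id: "jac id p = mat 1"
  by (rule jac_eqI) (simp add: id_def)

lemma holomorphic_map_on_funpow:
  assumes f: "holomorphic_map_on f U"
  shows "holomorphic_map_on (f ^^ n) {p. \<forall>j<n. (f ^^ j) p \<in> U}"
proof (induction n)
  case 0
  then show ?case using holomorphic_map_on_id by (simp add: id_def)
next
  case (Suc n)
  have "{p. \<forall>j<Suc n. (f ^^ j) p \<in> U} = {p. \<forall>j<n. (f ^^ j) p \<in> U} \<inter> (f ^^ n) -` U"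
    by (auto simp: less_Suc_eq)
  then show ?case using holomorphic_map_on_compose[OF Suc f] by (simp only: funpow.simps)
qed

lemma jac_funpow_fixed:
  assumes f: "holomorphic_map_on f U" and q: "q \<in> U" "f q = q"
  shows "jac (f ^^ n) q = matpow (jac f q) n"
proof (induction n)
  case 0
  then show ?case using jac_id by (simp add: id_def)
next
  case (Suc n)
  have fix_q: "(f ^^ j) q = q" for j using q(2) by (induction j) auto
  have "jac (f \<circ> (f ^^ n)) q = jac f ((f ^^ n) q) ** jac (f ^^ n) q"
    by (rule jac_compose[OF holomorphic_map_on_funpow[OF f] _ f]) (simp_all add: fix_q q)
  then have "jac (f \<circ> (f ^^ n)) q = jac f q ** matpow (jac f q) n" by (simp only: fix_q Suc)
  then show ?case by (simp only: funpow.simps matpow_simps)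
qed

text \<open>The inverse given by the real theorem has as derivative the inverse of a complex matrix,
  which is again complex linear. \<open>B\<close> turns Jacobians into the bounded operators which
  that theorem expects.\<close>

lemma holomorphic_inverse_function:
  assumes f: "holomorphic_map_on f U" and q: "q \<in> U" and det: "det (jac f q) \<noteq> 0"
  obtains U' V g where "open U'" "U' \<subseteq> U" "q \<in> U'" "open V" "f q \<in> V" "homeomorphism U' V f g"
    "holomorphic_map_on g V"
proof -
  obtain K where K: "K > 0" "\<And>A v. norm ((A :: complex^2^2) *v v) \<le> norm A * norm v * K"
    using bounded_bilinear.pos_bounded[OF bounded_bilinear_matrix_vector_mult] by blast
  define B where "B = (\<lambda>A :: complex^2^2. Blinfun (\<lambda>v. A *v v))"
  have B: "blinfun_apply (B A) = (\<lambda>v. A *v v)" for A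
    unfolding B_def by (rule bounded_linear_Blinfun_apply[OF bounded_linear_matrix_vector_mult])
  have "dist (B A) (B A') \<le> K * dist A A'" for A A'
    unfolding dist_norm
  proof (rule norm_blinfun_bound)
    fix v
    have "blinfun_apply (B A - B A') v = (A - A') *v v"
      by (simp add: B blinfun.diff_left matrix_vector_mult_diff_rdistrib)
    then show "norm (blinfun_apply (B A - B A') v) \<le> K * norm (A - A') * norm v"
      using K(2)[of "A - A'" v] by (simp add: ac_simps)
  qed (use K in simp)
  then have "K-lipschitz_on UNIV B" using K(1) by (intro lipschitz_onI) auto
  then have "continuous_on UNIV B" by (rule lipschitz_on_continuous_on)
  then have contB: "continuous_on U (\<lambda>x. B (jac f x))"
    by (rule continuous_on_compose2[OF _ continuous_on_jac[OF f]]) simp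
  obtain C where C: "C ** jac f q = mat 1"
    using det unfolding invertible_det_nz[symmetric] invertible_def by blast
  have inv: "B C o\<^sub>L B (jac f q) = id_blinfun"
    by (rule blinfun_eqI) (simp add: B matrix_vector_mul_assoc C)
  have oU: "open U" using f by (simp add: holomorphic_map_on_def)
  obtain U' V g g' where *: "open U'" "U' \<subseteq> U" "q \<in> U'" "open V" "f q \<in> V" "homeomorphism U' V f g"
    "\<And>y. y \<in> V \<Longrightarrow> (g has_derivative (g' y)) (at y)"
    "\<And>y. y \<in> V \<Longrightarrow> g' y = inv (blinfun_apply (B (jac f (g y))))"
    "\<And>y. y \<in> V \<Longrightarrow> bij (blinfun_apply (B (jac f (g y))))"
  proof (rule inverse_function_theorem[OF oU _ contB q inv])
    show "(f has_derivative blinfun_apply (B (jac f x))) (at x)" if "x \<in> U" for x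
      using has_derivative_jac[OF f that] by (simp only: B)
  qed blast
  have "holomorphic_map_on g V"
    unfolding holomorphic_map_on_def
  proof (intro conjI ballI)
    fix y assume y: "y \<in> V"
    let ?A = "jac f (g y)"
    have bij: "bij ((*v) ?A)" using *(9)[OF y] by (simp add: B)
    then obtain C where C: "C ** ?A = mat 1"
      using bij_is_inj matrix_left_invertible_injective by metis
    then have "?A ** C = mat 1" by (simp add: matrix_left_right_inverse)
    then have "inv ((*v) ?A) = (*v) C"
      using C by (intro inv_equality) (simp_all add: matrix_vector_mul_assoc)
    then have "g' y = (*v) C" using *(8)[OF y] by (simp add: B)
    then show "\<exists>J :: complex^2^2. (g has_derivative (\<lambda>v. J *v v)) (at y)" using *(7)[OF y] by metis
  qed (rule *)
  then show thesis by (rule that[OF *(1-6)])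
qed

section \<open>Local dynamics at fixed points\<close>

lemma matrix_vector_mult_bounded:
  fixes A :: "complex^2^2"
  obtains M where "M > 0" "\<And>v. norm (A *v v) \<le> M * norm v"
proof -
  obtain M where "\<forall>v. norm (A *v v) \<le> norm v * M" "M > 0"
    using bounded_linear.pos_bounded[OF bounded_linear_matrix_vector_mult] by blast
  then show thesis using that by (simp add: mult.commute)
qed

lemma matrix_vector_mult_bounded_below:
  fixes A :: "complex^2^2"
  assumes "det A \<noteq> 0"
  obtains c where "c > 0" "\<And>v. c * norm v \<le> norm (A *v v)"
proof -
  obtain C where C: "C ** A = mat 1"
    using assms unfolding invertible_det_nz[symmetric] invertible_def by blast
  obtain M where M: "M > 0" "\<And>v. norm (C *v v) \<le> M * norm v"
    using matrix_vector_mult_bounded[of C] by blast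
  show thesis
  proof (rule that[of "1 / M"])
    fix v
    have "norm v = norm (C *v (A *v v))" by (simp add: matrix_vector_mul_assoc C)
    then show "1 / M * norm v \<le> norm (A *v v)" using M(2)[of "A *v v"] M(1) by (simp add: field_simps)
  qed (use M in simp)
qed

lemma holomorphic_map_isCont: "holomorphic_map_on f U \<Longrightarrow> p \<in> U \<Longrightarrow> isCont f p"
  by (metis has_derivative_jac has_derivative_continuous)

text \<open>If G^n p = p, the differences G^i (G p) - G^i p telescope to 0. By strict
  differentiability their sum is close to (I + J + ... + J^(n-1)) (G p - p), and this matrix is
  bounded below, so G p - p vanishes.\<close>

lemma fixed_points_of_funpow_near:
  assumes G: "holomorphic_map_on G W" "q \<in> W" "G q = q" and n: "n > 0"
    and det: "det (\<Sum>i<n. matpow (jac G q) i) \<noteq> 0"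
  shows "\<exists>\<delta>>0. \<forall>p\<in>ball q \<delta>. (G ^^ n) p = p \<longrightarrow> G p = p"
proof -
  let ?J = "matpow (jac G q)"
  obtain c where c: "c > 0" "\<And>v. c * norm v \<le> norm ((\<Sum>i<n. ?J i) *v v)"
    using matrix_vector_mult_bounded_below[OF det] by blast
  have fix_q: "(G ^^ j) q = q" for j using G(3) by (induction j) auto
  \<comment> \<open>The \<open>n\<close> error terms then add up to half of the lower bound.\<close>
  define \<epsilon> where "\<epsilon> = c / (2 * n)"
  have \<epsilon>: "\<epsilon> > 0" using c n by (simp add: \<epsilon>_def)
  have "\<exists>\<delta>>0. \<forall>x\<in>ball q \<delta>. \<forall>y\<in>ball q \<delta>. norm ((G ^^ i) x - (G ^^ i) y - ?J i *v (x - y)) \<le> \<epsilon> * norm (x - y)" for i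
  proof -
    have "q \<in> {p. \<forall>j<i. (G ^^ j) p \<in> W}" using G(2) by (simp add: fix_q)
    from strict_derivative[OF holomorphic_map_on_funpow[OF G(1)] this \<epsilon>] show ?thesis
      unfolding jac_funpow_fixed[OF G] by blast
  qed
  then obtain d where d: "\<And>i. d i > 0" "\<And>i x y. x \<in> ball q (d i) \<Longrightarrow> y \<in> ball q (d i) \<Longrightarrow>
      norm ((G ^^ i) x - (G ^^ i) y - ?J i *v (x - y)) \<le> \<epsilon> * norm (x - y)"
    by metis
  define \<delta> where "\<delta> = Min (d ` {..<n})"
  have \<delta>: "\<delta> > 0" "\<And>i. i < n \<Longrightarrow> \<delta> \<le> d i" using n d(1) by (auto simp: \<delta>_def Min_gr_iff lessThan_empty_iff)
  obtain \<eta> where \<eta>: "\<eta> > 0" "\<And>p. dist p q < \<eta> \<Longrightarrow> dist (G p) q < \<delta>"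
    using holomorphic_map_isCont[OF G(1,2)] \<delta>(1) unfolding continuous_at_eps_delta G(3) by blast
  have "G p = p" if p: "p \<in> ball q (min \<delta> \<eta>)" "(G ^^ n) p = p" for p
  proof -
    let ?h = "G p - p"
    have close: "p \<in> ball q (d i)" "G p \<in> ball q (d i)" if "i < n" for i
      using p(1) \<eta>(2)[of p] \<delta>(2)[OF that] by (auto simp: dist_commute)
    have "(\<Sum>i<n. (G ^^ i) (G p) - (G ^^ i) p) = (\<Sum>i<n. (G ^^ Suc i) p - (G ^^ i) p)"
      by (simp add: funpow_swap1)
    also have "\<dots> = 0" using p(2) sum_lessThan_telescope[of "\<lambda>i. (G ^^ i) p" n] by simp
    finally have tel: "(\<Sum>i<n. (G ^^ i) (G p) - (G ^^ i) p) = 0" .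
    have "(\<Sum>i<n. ?J i) *v ?h = (\<Sum>i<n. ?J i *v ?h)"
      by (induction n) (simp_all add: matrix_vector_mult_add_rdistrib del: matpow_simps(2))
    also have "\<dots> = - (\<Sum>i<n. (G ^^ i) (G p) - (G ^^ i) p - ?J i *v ?h)"
      by (simp only: sum_subtractf[of "\<lambda>i. (G ^^ i) (G p) - (G ^^ i) p"] tel) simp
    also have "norm \<dots> \<le> (\<Sum>i<n. \<epsilon> * norm ?h)"
      unfolding norm_minus_cancel using d(2) close by (intro sum_norm_le) auto
    also have "\<dots> = c / 2 * norm ?h" using n by (simp add: \<epsilon>_def)
    finally have "c * norm ?h \<le> c / 2 * norm ?h" using c(2)[of ?h] by linarith
    then show "G p = p" using c(1) by (simp add: mult_le_cancel_right)
  qed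
  then show ?thesis using \<delta>(1) \<eta>(1) by (intro exI[of _ "min \<delta> \<eta>"]) auto
qed

lemma det_minus_one: "det (J - mat 1) = det J - trace J + (1 :: complex)" for J :: "complex^2^2"
  by (simp add: det_2 trace_def sum_2 mat_def algebra_simps)

text \<open>The equation says det (J - I) = 0, that is, 1 is an eigenvalue and the determinant is
  the other one. Were J - I invertible, G p - p would be bounded below by a multiple of p - q near
  \<open>q\<close>.\<close>

lemma trace_at_nonisolated_fixed_point:
  assumes G: "holomorphic_map_on G W" "q \<in> W" "G q = q" and lim: "q islimpt {p \<in> W. G p = p}"
  shows "trace (jac G q) = 1 + det (jac G q)"
proof (rule ccontr)
  assume "\<not> ?thesis"
  then have "det (jac G q - mat 1) \<noteq> 0" by (auto simp: det_minus_one algebra_simps)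
  then obtain c where c: "c > 0" "\<And>v. c * norm v \<le> norm ((jac G q - mat 1) *v v)"
    using matrix_vector_mult_bounded_below by blast
  have "c / 2 > 0" using c by simp
  from strict_derivative[OF G(1,2) this] obtain \<delta> where \<delta>: "\<delta> > 0"
    "\<And>x y. x \<in> ball q \<delta> \<Longrightarrow> y \<in> ball q \<delta> \<Longrightarrow> norm (G x - G y - jac G q *v (x - y)) \<le> c / 2 * norm (x - y)"
    by metis
  obtain p where p: "G p = p" "p \<noteq> q" "dist p q < \<delta>"
    using lim \<delta>(1) unfolding islimpt_approachable by blast
  have "norm (G p - G q - jac G q *v (p - q)) \<le> c / 2 * norm (p - q)"
    using \<delta> p(3) by (intro \<delta>(2)) (auto simp: dist_commute)
  moreover have "G p - G q - jac G q *v (p - q) = - ((jac G q - mat 1) *v (p - q))"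
    using p(1) G(3) by (simp add: matrix_vector_mult_diff_rdistrib)
  ultimately have "norm ((jac G q - mat 1) *v (p - q)) \<le> c / 2 * norm (p - q)"
    by (metis norm_minus_cancel)
  then have "c * norm (p - q) \<le> c / 2 * norm (p - q)" using c(2)[of "p - q"] by linarith
  then show False using c(1) p(2) by (simp add: mult_le_cancel_right)
qed

text \<open>The first coordinate of \<open>R *v p\<close> is constant along the lines in the eigendirection for
  \<open>det J\<close>, and \<open>E\<close> selects a coordinate in which this direction does not vanish.\<close>

lemma eigenline_coordinates:
  fixes J :: "complex^2^2"
  assumes tr: "trace J = 1 + det J" and ne: "det J \<noteq> 1"
  obtains R E :: "complex^2^2" where "det (R + E ** (J - mat 1)) \<noteq> 0"
    "\<And>d. (R *v d) $ 1 = 0 \<Longrightarrow> J *v d = det J *s d" "\<And>v. (R *v v) $ 2 = 0" "\<And>v. (E *v v) $ 1 = 0"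
proof -
  define A where "A = J - mat 1"
  define \<mu> where "\<mu> = det J - 1"
  have \<mu>: "\<mu> \<noteq> 0" using ne by (simp add: \<mu>_def)
  have tA: "A$2$2 = \<mu> - A$1$1"
    using tr by (simp add: A_def trace_def sum_2 mat_def \<mu>_def algebra_simps)
  have "det A = 0" unfolding A_def det_minus_one using tr by simp
  then have dA: "A$1$1 * A$2$2 = A$1$2 * A$2$1" by (simp add: det_2)
  \<comment> \<open>\<open>A\<close> is singular with trace \<open>\<mu>\<close> different from 0,
    so its image is its eigenline for \<open>\<mu>\<close>, spanned by any nonzero column. The first
    row of \<open>R\<close> annihilates column \<open>k\<close>.\<close>
  have "A$1$1 \<noteq> 0 \<or> A$2$2 \<noteq> 0" using tA \<mu> by auto
  then obtain k where k: "A$k$k \<noteq> 0" by blast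
  have k2: "k = 1 \<or> k = 2" using exhaust_2 by blast
  define R :: "complex^2^2" where "R = vector [vector [A$2$k, - A$1$k], 0]"
  define E :: "complex^2^2" where "E = vector [0, axis k 1]"
  show thesis
  proof (rule that[of R E])
    have "det (R + E ** A) = A$k$k * \<mu>"
      using k2 dA by (elim disjE) (simp_all add: det_2 R_def E_def matrix_matrix_mult_def sum_2 axis_def tA algebra_simps)
    then show "det (R + E ** (J - mat 1)) \<noteq> 0" using k \<mu> by (simp add: A_def)
    fix d :: "complex^2" assume "(R *v d) $ 1 = 0"
    then have "A$2$k * d$1 = A$1$k * d$2" by (simp add: R_def matrix_vector_mult_def sum_2)
    moreover have key: "x * (x * u + y * v) = x * ((x + w) * u) \<and> x * (z * u + w * v) = x * ((x + w) * v)"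
      if "x * w = y * z" "z * u = x * v" for x y z w u v :: complex
      using that by algebra
    moreover have mv: "(A *v d)$i = A$i$1 * d$1 + A$i$2 * d$2" for i
      by (simp add: matrix_vector_mult_def sum_2)
    moreover have "\<mu> = A$1$1 + A$2$2" by (simp add: tA)
    ultimately have "A$k$k * (A *v d)$1 = A$k$k * (\<mu> * d$1) \<and> A$k$k * (A *v d)$2 = A$k$k * (\<mu> * d$2)"
      using k2 dA key[of "A$1$1" "A$2$2" "A$1$2" "A$2$1" "d$1" "d$2"]
        key[of "A$2$2" "A$1$1" "A$2$1" "A$1$2" "d$2" "d$1"]
      by (elim disjE) (simp_all add: ac_simps)
    then have "(A *v d)$1 = \<mu> * d$1 \<and> (A *v d)$2 = \<mu> * d$2" using k by simp
    then have "A *v d = \<mu> *s d" by (simp add: vec_eq_iff forall_2)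
    then have "J *v d - d = (det J - 1) *s d"
      by (simp add: A_def \<mu>_def matrix_vector_mult_diff_rdistrib)
    then show "J *v d = det J *s d" by (simp add: vec_eq_iff algebra_simps)
  qed (simp_all add: R_def E_def matrix_vector_mult_def sum_2)
qed

text \<open>The curve is obtained by inverting the map whose coordinates are those of \<open>R *v p\<close> and
  \<open>E *v (G p - p)\<close>; its fixed points accumulate, so it consists of fixed points.\<close>

lemma nonisolated_fixed_point_curve:
  assumes G: "holomorphic_map_on G W" "q \<in> W" "G q = q" and lim: "q islimpt {p \<in> W. G p = p}"
    and ne: "det (jac G q) \<noteq> 1"
  obtains t0 \<rho> \<gamma> R \<delta> where "\<rho> > 0" "\<delta> > 0" "continuous_on (ball t0 \<rho>) \<gamma>" "\<gamma> t0 = q" "t0 = (R *v q) $ 1"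
    "\<And>t. t \<in> ball t0 \<rho> \<Longrightarrow> \<gamma> t \<in> W \<and> G (\<gamma> t) = \<gamma> t \<and> (R *v \<gamma> t) $ 1 = t \<and> (\<exists>w. (\<gamma> has_derivative (\<lambda>s. s *s w)) (at t))"
    "\<And>p. p \<in> ball q \<delta> \<Longrightarrow> G p = p \<Longrightarrow> (R *v p) $ 1 \<in> ball t0 \<rho> \<and> p = \<gamma> ((R *v p) $ 1)"
    "\<And>d. ((R :: complex^2^2) *v d) $ 1 = 0 \<Longrightarrow> jac G q *v d = det (jac G q) *s d"
proof -
  obtain R E :: "complex^2^2" where R: "det (R + E ** (jac G q - mat 1)) \<noteq> 0"
    "\<And>d. (R *v d) $ 1 = 0 \<Longrightarrow> jac G q *v d = det (jac G q) *s d"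
    "\<And>v. (R *v v) $ 2 = 0" "\<And>v. (E *v v) $ 1 = 0"
    by (rule eigenline_coordinates[OF trace_at_nonisolated_fixed_point[OF G lim] ne]) (rule that; assumption)
  define \<Phi> where "\<Phi> = (\<lambda>p. R *v p + E *v (G p - p))"
  have oW: "open W" using G(1) by (simp add: holomorphic_map_on_def)
  have d\<Phi>: "(\<Phi> has_derivative (\<lambda>v. (R + E ** (jac G p - mat 1)) *v v)) (at p)" if "p \<in> W" for p
  proof -
    have "(\<Phi> has_derivative (\<lambda>v. R *v v + E *v (jac G p *v v - v))) (at p)"
      unfolding \<Phi>_def using has_derivative_jac[OF G(1) that]
      by (intro has_derivative_add bounded_linear.has_derivative[OF bounded_linear_matrix_vector_mult]
          has_derivative_diff has_derivative_ident)
    then show ?thesis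
      by (simp add: matrix_vector_mult_add_rdistrib matrix_vector_mult_diff_rdistrib flip: matrix_vector_mul_assoc)
  qed
  then have hol\<Phi>: "holomorphic_map_on \<Phi> W" using oW unfolding holomorphic_map_on_def by blast
  have "det (jac \<Phi> q) \<noteq> 0" using jac_eqI[OF d\<Phi>[OF G(2)]] R(1) by simp
  then obtain U' V \<Psi> where U': "open U'" "U' \<subseteq> W" "q \<in> U'"
    and V: "open V" "\<Phi> q \<in> V" and hom: "homeomorphism U' V \<Phi> \<Psi>" and hol\<Psi>: "holomorphic_map_on \<Psi> V"
    by (rule holomorphic_inverse_function[OF hol\<Phi> G(2)]) (rule that; assumption)
  \<comment> \<open>At fixed points the \<open>E\<close> term vanishes, so \<open>\<Phi>\<close>
    sends them to the first axis; the curve is the preimage of that axis.\<close>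
  have \<Phi>_fix: "\<Phi> p = axis 1 ((R *v p) $ 1)" if "G p = p" for p
    unfolding vec_eq_iff forall_2 using R(3) that by (simp add: \<Phi>_def axis_def)
  define t0 where "t0 = (R *v q) $ 1"
  define \<gamma> where "\<gamma> = (\<lambda>t. \<Psi> (axis 1 t))"
  have axis: "axis 1 t = 0 + t *s (axis 1 1 :: complex^2)" for t by (simp add: vec_eq_iff axis_def)
  have d_axis: "((\<lambda>t. axis 1 t :: complex^2) has_derivative (\<lambda>s. s *s axis 1 1)) (at t)" for t
    using has_derivative_line[of 0 "axis 1 1" t] by (simp only: axis[symmetric])
  have cont_axis: "continuous_on UNIV (\<lambda>t. axis 1 t :: complex^2)"
    by (intro continuous_at_imp_continuous_on ballI has_derivative_continuous[OF d_axis])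
  have "open ((\<lambda>t. axis 1 t) -` V)" using cont_axis V(1) by (simp add: continuous_on_open_vimage)
  moreover have "t0 \<in> (\<lambda>t. axis 1 t) -` V" using V(2) \<Phi>_fix[OF G(3)] by (simp add: t0_def)
  ultimately obtain \<rho> where \<rho>: "\<rho> > 0" "ball t0 \<rho> \<subseteq> (\<lambda>t. axis 1 t) -` V"
    by (meson open_contains_ball)
  have \<gamma>_props: "\<gamma> t \<in> U'" "(R *v \<gamma> t) $ 1 = t" "\<exists>w. (\<gamma> has_derivative (\<lambda>s. s *s w)) (at t)" if "t \<in> ball t0 \<rho>" for t
  proof -
    have t: "axis 1 t \<in> V" using that \<rho>(2) by blast
    then show "\<gamma> t \<in> U'" unfolding \<gamma>_def using hom by (auto simp: homeomorphism_def)
    have "\<Phi> (\<gamma> t) = axis 1 t" unfolding \<gamma>_def using homeomorphism_apply2[OF hom t] .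
    moreover have "\<Phi> (\<gamma> t) $ 1 = (R *v \<gamma> t) $ 1" using R(4) by (simp add: \<Phi>_def)
    ultimately show "(R *v \<gamma> t) $ 1 = t" by (simp add: axis_def)
    have "(\<gamma> has_derivative (\<lambda>s. jac \<Psi> (axis 1 t) *v (s *s axis 1 1))) (at t)"
      unfolding \<gamma>_def by (rule has_derivative_compose[OF d_axis has_derivative_jac[OF hol\<Psi> t]])
    then show "\<exists>w. (\<gamma> has_derivative (\<lambda>s. s *s w)) (at t)"
      unfolding vector_scalar_commute by blast
  qed
  have cont\<gamma>: "continuous_on (ball t0 \<rho>) \<gamma>"
  proof (intro continuous_at_imp_continuous_on ballI)
    fix t assume "t \<in> ball t0 \<rho>"
    from \<gamma>_props(3)[OF this] show "isCont \<gamma> t" by (metis has_derivative_continuous)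
  qed
  have \<gamma>_fix: "p = \<gamma> ((R *v p) $ 1)" if "p \<in> U'" "G p = p" for p
    using homeomorphism_apply1[OF hom that(1)] \<Phi>_fix[OF that(2)] by (simp add: \<gamma>_def)
  have \<gamma>0: "\<gamma> t0 = q" using \<gamma>_fix[OF U'(3) G(3)] by (simp add: t0_def)
  have "isCont (\<lambda>p. (R *v p) $ 1) q"
    by (intro bounded_linear.isCont[OF bounded_linear_compose[OF bounded_linear_vec_nth bounded_linear_matrix_vector_mult]] continuous_ident)
  then obtain \<delta>1 where \<delta>1: "\<delta>1 > 0" "\<And>p. dist p q < \<delta>1 \<Longrightarrow> dist ((R *v p) $ 1) t0 < \<rho>"
    using \<rho>(1) unfolding continuous_at_eps_delta t0_def by blast
  obtain \<delta>2 where \<delta>2: "\<delta>2 > 0" "ball q \<delta>2 \<subseteq> U'" using U' open_contains_ball by blast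
  have near: "(R *v p) $ 1 \<in> ball t0 \<rho> \<and> p = \<gamma> ((R *v p) $ 1)" if "p \<in> ball q (min \<delta>1 \<delta>2)" "G p = p" for p
  proof
    show "(R *v p) $ 1 \<in> ball t0 \<rho>" using \<delta>1(2)[of p] that(1) by (simp add: dist_commute)
    show "p = \<gamma> ((R *v p) $ 1)" using that \<delta>2(2) by (intro \<gamma>_fix) auto
  qed
  let ?Z = "{t \<in> ball t0 \<rho>. G (\<gamma> t) = \<gamma> t}"
  have limZ: "t0 islimpt ?Z"
    unfolding islimpt_approachable
  proof (intro allI impI)
    fix e :: real assume e: "e > 0"
    have "isCont (\<lambda>p. (R *v p) $ 1) q"
      by (intro bounded_linear.isCont[OF bounded_linear_compose[OF bounded_linear_vec_nth bounded_linear_matrix_vector_mult]] continuous_ident)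
    then obtain \<eta> where \<eta>: "\<eta> > 0" "\<And>p. dist p q < \<eta> \<Longrightarrow> dist ((R *v p) $ 1) t0 < e"
      using e unfolding continuous_at_eps_delta t0_def by blast
    have "min \<eta> (min \<delta>1 \<delta>2) > 0" using \<eta>(1) \<delta>1(1) \<delta>2(1) by simp
    then obtain p where p: "G p = p" "p \<noteq> q" "dist p q < min \<eta> (min \<delta>1 \<delta>2)"
      using lim unfolding islimpt_approachable by blast
    have "(R *v p) $ 1 \<in> ball t0 \<rho> \<and> p = \<gamma> ((R *v p) $ 1)"
      using p by (intro near) (auto simp: dist_commute)
    moreover from this have "(R *v p) $ 1 \<noteq> t0" using p(2) \<gamma>0 by metis
    moreover have "dist ((R *v p) $ 1) t0 < e" using \<eta>(2) p(3) by simp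
    ultimately show "\<exists>x'\<in>?Z. x' \<noteq> t0 \<and> dist x' t0 < e"
      using p(1) by (intro bexI[of _ "(R *v p) $ 1"]) auto
  qed
  have "G (\<gamma> t) = \<gamma> t" if t: "t \<in> ball t0 \<rho>" for t
  proof -
    have "(G (\<gamma> t)) $ i - (\<gamma> t) $ i = 0" for i
    proof (rule analytic_continuation[where f = "\<lambda>t. G (\<gamma> t) $ i - \<gamma> t $ i" and w = t
          and S = "ball t0 \<rho>" and U = ?Z and \<xi> = t0])
      \<comment> \<open>Writing the curve as \<open>id\<close> after \<open>\<gamma>\<close> lets
        the rule for derivatives along curves handle both terms.\<close>
      have "(\<lambda>t. G (\<gamma> t) $ i - id (\<gamma> t) $ i) field_differentiable (at s)" if s: "s \<in> ball t0 \<rho>" for s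
      proof -
        obtain w where w: "(\<gamma> has_derivative (\<lambda>s. s *s w)) (at s)" using \<gamma>_props(3)[OF s] by blast
        have "\<gamma> s \<in> W" using \<gamma>_props(1)[OF s] U'(2) by blast
        then show ?thesis
          unfolding field_differentiable_def
          using DERIV_diff[OF has_field_derivative_along_curve[OF has_derivative_jac[OF G(1)] w]
              has_field_derivative_along_curve[OF has_derivative_jac[OF holomorphic_map_on_id] w]]
          by blast
      qed
      then show "(\<lambda>t. G (\<gamma> t) $ i - \<gamma> t $ i) holomorphic_on ball t0 \<rho>"
        unfolding holomorphic_on_def id_apply by (meson field_differentiable_at_within)
    qed (use limZ t \<rho> in auto)
    then show ?thesis by (simp add: vec_eq_iff)
  qed
  then have "\<gamma> t \<in> W \<and> G (\<gamma> t) = \<gamma> t \<and> (R *v \<gamma> t) $ 1 = t \<and> (\<exists>w. (\<gamma> has_derivative (\<lambda>s. s *s w)) (at t))"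
    if "t \<in> ball t0 \<rho>" for t using \<gamma>_props[OF that] U'(2) that by blast
  moreover have "min \<delta>1 \<delta>2 > 0" using \<delta>1(1) \<delta>2(1) by simp
  ultimately show thesis by (intro that[OF \<rho>(1) _ cont\<gamma> \<gamma>0 t0_def _ near R(2)])
qed

text \<open>The displacement G p - p shrinks geometrically: \<open>p\<close> differs from a fixed
  point on the curve by a vector in the eigenline for \<Lambda>, so the displacement is almost in
  that line and \<open>G\<close> multiplies it by about \<Lambda>. Hence a nonfixed point close to
  \<open>q\<close> has an orbit that stays close and never repeats.\<close>

lemma infinite_orbit_near_semiattracting_point:
  assumes G: "holomorphic_map_on G W" "q \<in> W" "G q = q" and lim: "q islimpt {p \<in> W. G p = p}"
    and inj: "inj_on G W" and small: "norm (det (jac G q)) < 1" and e: "e > 0"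
  obtains p where "\<And>n. (G ^^ n) p \<in> ball q e" "infinite (range (\<lambda>n. (G ^^ n) p))"
proof -
  define \<Lambda> where "\<Lambda> = det (jac G q)"
  have \<Lambda>: "norm \<Lambda> < 1" "\<Lambda> \<noteq> 1" using small by (auto simp: \<Lambda>_def)
  have ne: "det (jac G q) \<noteq> 1" using \<Lambda>(2) by (simp add: \<Lambda>_def)
  obtain t0 \<rho> \<gamma> R \<delta>' where curve: "\<rho> > 0" "\<delta>' > 0" "continuous_on (ball t0 \<rho>) \<gamma>" "\<gamma> t0 = q" "t0 = (R *v q) $ 1"
    "\<And>t. t \<in> ball t0 \<rho> \<Longrightarrow> \<gamma> t \<in> W \<and> G (\<gamma> t) = \<gamma> t \<and> (R *v \<gamma> t) $ 1 = t \<and> (\<exists>w. (\<gamma> has_derivative (\<lambda>s. s *s w)) (at t))"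
    "\<And>p. p \<in> ball q \<delta>' \<Longrightarrow> G p = p \<Longrightarrow> (R *v p) $ 1 \<in> ball t0 \<rho> \<and> p = \<gamma> ((R *v p) $ 1)"
    "\<And>d. ((R :: complex^2^2) *v d) $ 1 = 0 \<Longrightarrow> jac G q *v d = det (jac G q) *s d"
    by (rule nonisolated_fixed_point_curve[OF G lim ne]) (rule that; assumption)
  have R: "jac G q *v d = \<Lambda> *s d" if "(R *v d) $ 1 = 0" for d
    using curve(8)[OF that] by (simp add: \<Lambda>_def)
  define b where "b = norm (\<Lambda> - 1)"
  have b: "b > 0" using \<Lambda>(2) by (simp add: b_def)
  obtain M where M: "M > 0" "\<And>v. norm (jac G q *v v) \<le> M * norm v"
    by (rule matrix_vector_mult_bounded[of "jac G q"]) (rule that; assumption)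
  \<comment> \<open>\<open>\<kappa>\<close> is halfway between |\<Lambda>| and 1, \<open>C\<close>
    collects the error coefficients of the estimate below, and \<open>\<epsilon>\<close> makes
    |\<Lambda>| + C \<epsilon> at most \<open>\<kappa>\<close>. The bound b / 2 on
    \<open>\<epsilon>\<close> serves to estimate \<open>d\<close> by \<open>h\<close>.\<close>
  define \<kappa> where "\<kappa> = (1 + norm \<Lambda>) / 2"
  have \<kappa>: "0 < \<kappa>" "\<kappa> < 1" using \<Lambda>(1) by (simp_all add: \<kappa>_def add_pos_nonneg)
  define C where "C = 2 * (1 + M) / b + 1"
  have C: "C > 0" using M b by (simp add: C_def add_pos_pos)
  define \<epsilon> where "\<epsilon> = min (b / 2) ((1 - norm \<Lambda>) / 2 / C)"
  have \<epsilon>: "\<epsilon> > 0" "\<epsilon> \<le> b / 2" "C * \<epsilon> \<le> (1 - norm \<Lambda>) / 2"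
  proof -
    show "\<epsilon> > 0" "\<epsilon> \<le> b / 2" using b C \<Lambda>(1) by (simp_all add: \<epsilon>_def)
    have "\<epsilon> \<le> (1 - norm \<Lambda>) / 2 / C" by (simp add: \<epsilon>_def)
    then show "C * \<epsilon> \<le> (1 - norm \<Lambda>) / 2" using C by (simp add: pos_le_divide_eq ac_simps)
  qed
  obtain \<delta>1 where \<delta>1: "\<delta>1 > 0" "ball q \<delta>1 \<subseteq> W"
    "\<And>x y. x \<in> ball q \<delta>1 \<Longrightarrow> y \<in> ball q \<delta>1 \<Longrightarrow> norm (G x - G y - jac G q *v (x - y)) \<le> \<epsilon> * norm (x - y)"
    using strict_derivative[OF G(1,2) \<epsilon>(1)] by blast
  have "isCont (\<lambda>p. (R *v p) $ 1) q"
    by (intro bounded_linear.isCont[OF bounded_linear_compose[OF bounded_linear_vec_nth bounded_linear_matrix_vector_mult]] continuous_ident)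
  moreover have "isCont \<gamma> ((R *v q) $ 1)"
    using curve(1,3,5) by (simp add: continuous_on_eq_continuous_at)
  ultimately have "isCont (\<lambda>p. \<gamma> ((R *v p) $ 1)) q" by (rule isCont_o2)
  moreover have "\<gamma> ((R *v q) $ 1) = q" using curve(4,5) by simp
  ultimately obtain \<eta>1 where \<eta>1: "\<eta>1 > 0" "\<And>p. dist p q < \<eta>1 \<Longrightarrow> dist (\<gamma> ((R *v p) $ 1)) q < \<delta>1"
    using \<delta>1(1) unfolding continuous_at_eps_delta by metis
  obtain \<eta>2 where \<eta>2: "\<eta>2 > 0" "\<And>p. dist p q < \<eta>2 \<Longrightarrow> dist ((R *v p) $ 1) t0 < \<rho>"
    using \<open>isCont (\<lambda>p. (R *v p) $ 1) q\<close> curve(1,5) unfolding continuous_at_eps_delta by metis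
  obtain \<eta>3 where \<eta>3: "\<eta>3 > 0" "\<And>p. dist p q < \<eta>3 \<Longrightarrow> dist (G p) q < \<delta>1"
    using holomorphic_map_isCont[OF G(1,2)] \<delta>1(1) unfolding continuous_at_eps_delta G(3) by blast
  define \<delta> where "\<delta> = min e (min \<delta>1 (min \<eta>1 (min \<eta>2 \<eta>3)))"
  have \<delta>: "\<delta> > 0" "\<delta> \<le> e" "\<delta> \<le> \<delta>1" "\<delta> \<le> \<eta>1" "\<delta> \<le> \<eta>2" "\<delta> \<le> \<eta>3"
    using e \<delta>1(1) \<eta>1(1) \<eta>2(1) \<eta>3(1) by (simp_all add: \<delta>_def)
  have contract: "norm (G (G p) - G p) \<le> \<kappa> * norm (G p - p)" if p: "p \<in> ball q \<delta>" for p
  proof -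
    have pq: "dist p q < \<delta>" using p by (simp add: dist_commute)
    \<comment> \<open>The fixed point on the curve with the same \<open>R\<close>-coordinate as
      \<open>p\<close>: their difference lies in the eigenline.\<close>
    define c where "c = \<gamma> ((R *v p) $ 1)"
    have t: "(R *v p) $ 1 \<in> ball t0 \<rho>" using \<eta>2(2)[of p] pq \<delta>(5) by (simp add: dist_commute)
    have c: "c \<in> ball q \<delta>1" "G c = c" "(R *v (p - c)) $ 1 = 0"
      using \<eta>1(2)[of p] pq \<delta>(4) curve(6)[OF t] by (auto simp: c_def dist_commute matrix_vector_mult_diff_distrib)
    have pb: "p \<in> ball q \<delta>1" "G p \<in> ball q \<delta>1" using \<eta>3(2)[of p] pq \<delta>(3,6) by (auto simp: dist_commute)
    define d where "d = p - c"
    define h where "h = G p - p"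
    define r where "r = G p - c - \<Lambda> *s d"
    have Jd: "jac G q *v d = \<Lambda> *s d" using R[OF c(3)] by (simp add: d_def)
    have r: "norm r \<le> \<epsilon> * norm d"
      using \<delta>1(3)[OF pb(1) c(1)] Jd c(2) by (simp add: r_def d_def)
    have h: "h = (\<Lambda> - 1) *s d + r" by (simp add: h_def r_def d_def vec_eq_iff algebra_simps)
    have "norm ((\<Lambda> - 1) *s d) \<le> norm h + norm r"
      unfolding h by (metis add_diff_cancel_right' norm_triangle_ineq4)
    then have "b * norm d \<le> norm h + norm r" unfolding b_def norm_scalar_mult_cart .
    moreover have "norm r \<le> b / 2 * norm d" using r \<epsilon>(2) by (meson mult_right_mono norm_ge_zero order_trans)
    ultimately have d: "norm d \<le> 2 / b * norm h" using b by (simp add: field_simps)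
    \<comment> \<open>Up to the error \<open>r\<close>, the displacement \<open>h\<close> is
      (\<Lambda> - 1) d, on which the Jacobian acts as \<Lambda>.\<close>
    have "jac G q *v h = \<Lambda> *s (h - r) + jac G q *v r"
      unfolding h by (simp add: matrix_vector_right_distrib vector_scalar_commute Jd vec_eq_iff algebra_simps)
    then have "G (G p) - G p = \<Lambda> *s h + (jac G q *v r - \<Lambda> *s r + (G (G p) - G p - jac G q *v h))"
      by (simp add: vec_eq_iff algebra_simps)
    also have "norm \<dots> \<le> norm (\<Lambda> *s h) + (norm (jac G q *v r) + norm (\<Lambda> *s r) + norm (G (G p) - G p - jac G q *v h))"
      by (intro norm_triangle_le add_mono order_refl norm_triangle_ineq4)
    also have "\<dots> \<le> norm \<Lambda> * norm h + (M * norm r + 1 * norm r + \<epsilon> * norm h)"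
    proof -
      have "norm (\<Lambda> *s h) = norm \<Lambda> * norm h" by (rule norm_scalar_mult_cart)
      moreover have "norm (\<Lambda> *s r) \<le> 1 * norm r"
        unfolding norm_scalar_mult_cart using \<Lambda>(1) by (intro mult_right_mono) auto
      moreover have "norm (G (G p) - G p - jac G q *v h) \<le> \<epsilon> * norm h"
        using \<delta>1(3)[OF pb(2,1)] by (simp add: h_def)
      ultimately show ?thesis using M(2)[of r] by linarith
    qed
    also have "\<dots> = norm \<Lambda> * norm h + ((1 + M) * norm r + \<epsilon> * norm h)" by (simp add: algebra_simps)
    also have "\<dots> \<le> norm \<Lambda> * norm h + ((1 + M) * (\<epsilon> * (2 / b * norm h)) + \<epsilon> * norm h)"
    proof -
      have "norm r \<le> \<epsilon> * (2 / b * norm h)"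
        using r mult_left_mono[OF d, of \<epsilon>] \<epsilon>(1) by linarith
      then have "(1 + M) * norm r \<le> (1 + M) * (\<epsilon> * (2 / b * norm h))"
        using M(1) by (intro mult_left_mono) auto
      then show ?thesis by linarith
    qed
    also have "\<dots> = (norm \<Lambda> + C * \<epsilon>) * norm h" using b by (simp add: C_def field_simps)
    also have "\<dots> \<le> \<kappa> * norm h" using \<epsilon>(3) by (intro mult_right_mono) (auto simp: \<kappa>_def field_simps)
    finally show ?thesis by (simp add: h_def)
  qed
  have "isCont (\<lambda>p. norm (G p - p)) q"
    using holomorphic_map_isCont[OF G(1,2)] by (intro continuous_intros)
  then have cont: "\<forall>\<epsilon>>0. \<exists>\<eta>>0. \<forall>p. dist p q < \<eta> \<longrightarrow> norm (G p - p) < \<epsilon>"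
    unfolding continuous_at_eps_delta using G(3) by (simp add: dist_real_def)
  have "(1 - \<kappa>) * (\<delta> / 2) > 0" using \<kappa> \<delta>(1) by simp
  then obtain \<eta> where \<eta>: "\<eta> > 0" "\<And>p. dist p q < \<eta> \<Longrightarrow> norm (G p - p) < (1 - \<kappa>) * (\<delta> / 2)"
    using cont by blast
  \<comment> \<open>Were all nearby points fixed, the Jacobian would be the identity, with
    determinant 1.\<close>
  have "\<exists>p\<in>ball q (min \<eta> (\<delta> / 2)). G p \<noteq> p"
  proof (rule ccontr)
    assume neg: "\<not> ?thesis"
    have "(id has_derivative (\<lambda>v. mat 1 *v v)) (at q)" by (simp add: id_def)
    then have "(G has_derivative (\<lambda>v. mat 1 *v v)) (at q)"
      by (rule has_derivative_transform_within_open[of _ _ _ _ "ball q (min \<eta> (\<delta> / 2))"])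
         (use neg \<eta>(1) \<delta>(1) in auto)
    then have "jac G q = mat 1" by (rule jac_eqI)
    then show False using ne by simp
  qed
  then obtain p where p: "p \<in> ball q (min \<eta> (\<delta> / 2))" "G p \<noteq> p" by blast
  define h where "h = (\<lambda>n. norm ((G ^^ Suc n) p - (G ^^ n) p))"
  have h0: "h 0 < (1 - \<kappa>) * (\<delta> / 2)" using \<eta>(2)[of p] p(1) by (simp add: h_def dist_commute)
  \<comment> \<open>The drift is at most h 0 / (1 - \<kappa>) < \<delta> / 2 and the start is within
    \<delta> / 2 of \<open>q\<close>, so the contraction estimate remains applicable.\<close>
  have orbit: "(G ^^ n) p \<in> ball q \<delta> \<and> h n \<le> \<kappa> ^ n * h 0 \<and> norm ((G ^^ n) p - p) \<le> h 0 * (\<Sum>i<n. \<kappa> ^ i)" for n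
  proof (induction n)
    case 0
    then show ?case using p(1) \<delta>(1) by simp
  next
    case (Suc n)
    have "h (Suc n) \<le> \<kappa> * h n" using contract[of "(G ^^ n) p"] Suc by (simp add: h_def)
    also have "\<dots> \<le> \<kappa> * (\<kappa> ^ n * h 0)" using Suc \<kappa>(1) by (intro mult_left_mono) auto
    finally have 1: "h (Suc n) \<le> \<kappa> ^ Suc n * h 0" by simp
    have "norm ((G ^^ Suc n) p - p) \<le> h n + norm ((G ^^ n) p - p)"
      unfolding h_def by (metis add_diff_eq diff_add_cancel norm_triangle_ineq)
    also have "\<dots> \<le> \<kappa> ^ n * h 0 + h 0 * (\<Sum>i<n. \<kappa> ^ i)" using Suc by (intro add_mono) auto
    finally have 2: "norm ((G ^^ Suc n) p - p) \<le> h 0 * (\<Sum>i<Suc n. \<kappa> ^ i)" by (simp add: algebra_simps)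
    have "(\<Sum>i<Suc n. \<kappa> ^ i) = (1 - \<kappa> ^ Suc n) / (1 - \<kappa>)"
      using \<kappa> by (simp add: sum_gp_strict del: sum.lessThan_Suc power_Suc)
    also have "\<dots> \<le> 1 / (1 - \<kappa>)" using \<kappa> by (intro divide_right_mono) auto
    finally have "h 0 * (\<Sum>i<Suc n. \<kappa> ^ i) \<le> h 0 * (1 / (1 - \<kappa>))"
      by (intro mult_left_mono) (auto simp: h_def)
    also have "\<dots> < \<delta> / 2" using h0 \<kappa> by (simp add: field_simps)
    finally have "dist ((G ^^ Suc n) p) p < \<delta> / 2" using 2 by (simp add: dist_norm)
    then have "(G ^^ Suc n) p \<in> ball q \<delta>"
      using p(1) dist_triangle[of q "(G ^^ Suc n) p" p] by (simp add: dist_commute)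
    then show ?case using 1 2 by blast
  qed
  have inW: "(G ^^ n) p \<in> W" for n using orbit[of n] \<delta>(3) \<delta>1(2) by auto
  \<comment> \<open>Injectivity keeps the displacements nonzero. Being strictly decreasing they are
    distinct, hence so are the orbit points.\<close>
  have pos: "h n > 0" for n
  proof (induction n)
    case 0
    then show ?case using p(2) by (simp add: h_def)
  next
    case (Suc n)
    have "(G ^^ Suc (Suc n)) p \<noteq> (G ^^ Suc n) p"
    proof
      assume "(G ^^ Suc (Suc n)) p = (G ^^ Suc n) p"
      then have "(G ^^ Suc n) p = (G ^^ n) p"
        using inj_onD[OF inj _ inW[of "Suc n"] inW[of n]] by simp
      then show False using Suc by (simp add: h_def)
    qed
    then show ?case by (simp add: h_def)
  qed
  have desc: "h (Suc n) < h n" for n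
  proof -
    have "h (Suc n) \<le> \<kappa> * h n" using contract[of "(G ^^ n) p"] orbit[of n] by (simp add: h_def)
    also have "\<dots> < 1 * h n" using \<kappa>(2) pos[of n] by (intro mult_strict_right_mono) auto
    finally show ?thesis by simp
  qed
  have anti: "h m < h n" if "n < m" for m n
    using lift_Suc_mono_less[of "\<lambda>n. - h n", OF _ that] desc by simp
  have "inj (\<lambda>n. (G ^^ n) p)"
  proof (rule linorder_injI)
    fix m n :: nat assume "m < n"
    then have "h n < h m" by (rule anti)
    then show "(G ^^ m) p \<noteq> (G ^^ n) p" by (auto simp: h_def)
  qed
  then have "infinite (range (\<lambda>n. (G ^^ n) p))" by (rule range_inj_infinite)
  moreover have "(G ^^ n) p \<in> ball q e" for n using orbit[of n] \<delta>(2) by auto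
  ultimately show thesis using that by blast
qed

lemma spec_of_eigenvalue_one:
  assumes "trace J = 1 + det J"
  shows "spec J = (1 + det J, det J)"
  using assms by (simp add: spec_def)

text \<open>At a nonisolated fixed point the determinant determines the trace, and excluding (2, 1)
  makes it differ from 1, as the curve of fixed points requires. The bound |det| >= 1 for both
  \<open>G\<close> and its inverse \<open>H\<close> yields modulus exactly 1.\<close>

lemma spec_locally_constant_on_fixed_points:
  assumes G: "holomorphic_map_on G N" and H: "holomorphic_map_on H N" and q: "q \<in> N" "G q = q"
    and HG: "\<And>p. p \<in> N \<Longrightarrow> H (G p) = p" and GH: "\<And>p. p \<in> N \<Longrightarrow> G (H p) = p"
    and finG: "\<And>p. (\<And>n. (G ^^ n) p \<in> N) \<Longrightarrow> finite (range (\<lambda>n. (G ^^ n) p))"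
    and finH: "\<And>p. (\<And>n. (H ^^ n) p \<in> N) \<Longrightarrow> finite (range (\<lambda>n. (H ^^ n) p))"
    and spec: "spec (jac G q) \<noteq> (2, 1)"
  shows "\<exists>\<epsilon>>0. \<forall>p\<in>ball q \<epsilon>. G p = p \<longrightarrow> spec (jac G p) = spec (jac G q)"
proof (cases "q islimpt {p \<in> N. G p = p}")
  case False
  have "open N" using G by (simp add: holomorphic_map_on_def)
  then obtain e1 where e1: "e1 > 0" "ball q e1 \<subseteq> N" using q(1) open_contains_ball by blast
  obtain e2 where e2: "e2 > 0" "\<And>p. p \<in> N \<Longrightarrow> G p = p \<Longrightarrow> dist p q < e2 \<Longrightarrow> p = q"
    using False unfolding islimpt_approachable by blast
  have "p = q" if "p \<in> ball q (min e1 e2)" "G p = p" for p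
    using that e1(2) by (intro e2(2)) (auto simp: dist_commute)
  then have "\<forall>p\<in>ball q (min e1 e2). G p = p \<longrightarrow> spec (jac G p) = spec (jac G q)" by metis
  moreover have "min e1 e2 > 0" using e1(1) e2(1) by simp
  ultimately show ?thesis by blast
next
  case True
  have oN: "open N" using G by (simp add: holomorphic_map_on_def)
  have fix_iff: "G p = p \<longleftrightarrow> H p = p" if "p \<in> N" for p using HG[OF that] GH[OF that] by metis
  have inj: "inj_on G N" "inj_on H N" using HG GH by (metis inj_on_inverseI)+
  have modulus: "norm (det (jac K p)) \<ge> 1"
    if K: "holomorphic_map_on K N" "inj_on K N" "\<And>p. (\<And>n. (K ^^ n) p \<in> N) \<Longrightarrow> finite (range (\<lambda>n. (K ^^ n) p))"
      and p: "p \<in> N" "K p = p" "p islimpt {p \<in> N. K p = p}" for K p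
  proof (rule ccontr)
    assume "\<not> ?thesis"
    then have small: "norm (det (jac K p)) < 1" by simp
    obtain e where e: "e > 0" "ball p e \<subseteq> N" using p(1) oN open_contains_ball by blast
    obtain x where x: "\<And>n. (K ^^ n) x \<in> ball p e" "infinite (range (\<lambda>n. (K ^^ n) x))"
      by (rule infinite_orbit_near_semiattracting_point[OF K(1) p K(2) small e(1)]) (rule that; assumption)
    have "(K ^^ n) x \<in> N" for n using x(1) e(2) by blast
    then show False using K(3) x(2) by blast
  qed
  have ne: "det (jac G q) \<noteq> 1"
    using spec_of_eigenvalue_one[OF trace_at_nonisolated_fixed_point[OF G q True]] spec by auto
  obtain t0 \<rho> \<gamma> R \<delta> where curve: "\<rho> > 0" "\<delta> > 0" "continuous_on (ball t0 \<rho>) \<gamma>" "\<gamma> t0 = q" "t0 = (R *v q) $ 1"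
    "\<And>t. t \<in> ball t0 \<rho> \<Longrightarrow> \<gamma> t \<in> N \<and> G (\<gamma> t) = \<gamma> t \<and> (R *v \<gamma> t) $ 1 = t \<and> (\<exists>w. (\<gamma> has_derivative (\<lambda>s. s *s w)) (at t))"
    "\<And>p. p \<in> ball q \<delta> \<Longrightarrow> G p = p \<Longrightarrow> (R *v p) $ 1 \<in> ball t0 \<rho> \<and> p = \<gamma> ((R *v p) $ 1)"
    "\<And>d. ((R :: complex^2^2) *v d) $ 1 = 0 \<Longrightarrow> jac G q *v d = det (jac G q) *s d"
    by (rule nonisolated_fixed_point_curve[OF G q True ne]) (rule that; assumption)
  \<comment> \<open>The curve is injective, so each of its points, not just \<open>q\<close>, is a
    nonisolated fixed point.\<close>
  have lim: "\<gamma> t islimpt {p \<in> N. G p = p}" if t: "t \<in> ball t0 \<rho>" for t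
    unfolding islimpt_approachable
  proof (intro allI impI)
    fix e :: real assume e: "e > 0"
    have "isCont \<gamma> t" using curve(3) t by (simp add: continuous_on_eq_continuous_at)
    then obtain d where d: "d > 0" "\<And>s. dist s t < d \<Longrightarrow> dist (\<gamma> s) (\<gamma> t) < e"
      using e unfolding continuous_at_eps_delta by blast
    have "t islimpt ball t0 \<rho>" using t by (simp add: interior_limit_point)
    then obtain s where s: "s \<in> ball t0 \<rho>" "s \<noteq> t" "dist s t < d"
      using d(1) unfolding islimpt_approachable by blast
    have "\<gamma> s \<noteq> \<gamma> t" using curve(6)[OF s(1)] curve(6)[OF t] s(2) by metis
    then show "\<exists>x'\<in>{p \<in> N. G p = p}. x' \<noteq> \<gamma> t \<and> dist x' (\<gamma> t) < e"
      using curve(6)[OF s(1)] d(2)[OF s(3)] by (intro bexI[of _ "\<gamma> s"]) auto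
  qed
  define \<delta>t where "\<delta>t = (\<lambda>t. det (jac G (\<gamma> t)))"
  have unimodular: "norm (\<delta>t t) = 1" if t: "t \<in> ball t0 \<rho>" for t
  proof -
    let ?p = "\<gamma> t"
    have p: "?p \<in> N" "G ?p = ?p" "H ?p = ?p" using curve(6)[OF t] fix_iff by auto
    have "{p \<in> N. G p = p} = {p \<in> N. H p = p}" using fix_iff by blast
    then have limH: "?p islimpt {p \<in> N. H p = p}" using lim[OF t] by simp
    have 1: "norm (det (jac G ?p)) \<ge> 1" using modulus[OF G inj(1) finG p(1,2) lim[OF t]] .
    have 2: "norm (det (jac H ?p)) \<ge> 1" using modulus[OF H inj(2) finH p(1,3) limH] .
    have "(id has_derivative (\<lambda>v. mat 1 *v v)) (at ?p)" by (simp add: id_def)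
    then have "(H \<circ> G has_derivative (\<lambda>v. mat 1 *v v)) (at ?p)"
      by (rule has_derivative_transform_within_open[OF _ oN p(1)]) (simp add: HG)
    then have "jac (H \<circ> G) ?p = mat 1" by (rule jac_eqI)
    then have "jac H ?p ** jac G ?p = mat 1"
      using jac_compose[OF G p(1) H] p by simp
    then have "det (jac H ?p) * det (jac G ?p) = 1" by (metis det_I det_mul)
    then have "norm (det (jac H ?p)) * norm (det (jac G ?p)) = 1" by (metis norm_mult norm_one)
    then have "norm (det (jac G ?p)) \<le> 1"
      using 2 by (metis mult_right_mono norm_ge_zero mult_1)
    then show ?thesis using 1 by (simp add: \<delta>t_def)
  qed
  have "\<delta>t holomorphic_on ball t0 \<rho>"
    unfolding \<delta>t_def det_2
    by (intro holomorphic_intros holomorphic_jac_along_curve[OF G]) (use curve in auto)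
  \<comment> \<open>With constant modulus, the maximum is attained at the centre.\<close>
  then have "\<delta>t constant_on ball t0 \<rho>"
    by (rule maximum_modulus_principle[where U = "ball t0 \<rho>" and \<xi> = t0])
       (use unimodular curve(1) in auto)
  then have const: "\<delta>t t = \<delta>t t0" if "t \<in> ball t0 \<rho>" for t
    using that curve(1) unfolding constant_on_def by (metis centre_in_ball)
  have "spec (jac G p) = spec (jac G q)" if p: "p \<in> ball q \<delta>" "G p = p" for p
  proof -
    let ?t = "(R *v p) $ 1"
    have t: "?t \<in> ball t0 \<rho>" "p = \<gamma> ?t" using curve(7)[OF p] by auto
    have "spec (jac G (\<gamma> ?t)) = (1 + \<delta>t ?t, \<delta>t ?t)"
      unfolding \<delta>t_def using curve(6)[OF t(1)]
      by (intro spec_of_eigenvalue_one trace_at_nonisolated_fixed_point[OF G _ _ lim[OF t(1)]]) auto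
    moreover have "spec (jac G q) = (1 + \<delta>t t0, \<delta>t t0)"
      unfolding \<delta>t_def curve(4) by (intro spec_of_eigenvalue_one trace_at_nonisolated_fixed_point[OF G q True])
    ultimately show ?thesis using const[OF t(1)] t(2) by simp
  qed
  then show ?thesis using curve(2) by blast
qed

section \<open>Trapped points\<close>

text \<open>Two iterates coincide by finiteness, and the inverse carries the coincidence back to
  time 0.\<close>

lemma periodic_of_finite_orbit:
  assumes inv: "\<And>x. x \<in> W \<Longrightarrow> g (f x) = x" and orb: "\<And>n. (f ^^ n) p \<in> W"
    and fin: "finite (range (\<lambda>n. (f ^^ n) p))"
  obtains m where "m > 0" "(f ^^ m) p = p"
proof -
  have "\<not> inj (\<lambda>n. (f ^^ n) p)" using fin range_inj_infinite by blast
  then obtain i j where ij: "i < j" "(f ^^ i) p = (f ^^ j) p"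
    by (metis (mono_tags, lifting) injI linorder_neqE_nat)
  have "(f ^^ (j - i)) p = (g ^^ i) ((f ^^ j) p)"
    using ij(1) orb by (intro funpow_inverse_cancel[where W = W and g = g and f = f, OF inv, symmetric]) auto
  also have "\<dots> = (g ^^ i) ((f ^^ i) p)" by (simp add: ij(2))
  also have "\<dots> = (f ^^ (i - i)) p" by (rule funpow_inverse_cancel[where W = W and g = g and f = f, OF inv]) (auto simp: orb)
  finally show thesis using that[of "j - i"] ij(1) by simp
qed

lemma funpow_fixed_point: "h p = p \<Longrightarrow> (h ^^ n) p = p"
  by (induction n) auto

lemma backward_orbit_of_finite_orbit:
  assumes inv: "\<And>x. x \<in> W \<Longrightarrow> g (f x) = x" and orb: "\<And>n. (f ^^ n) p \<in> W"
    and fin: "finite (range (\<lambda>n. (f ^^ n) p))"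
  shows "(g ^^ n) p \<in> W"
proof -
  obtain m where m: "m > 0" "(f ^^ m) p = p"
    using periodic_of_finite_orbit[of W g f p, OF inv orb fin] by blast
  \<comment> \<open>Since m n >= n, the \<open>n\<close> backward steps only undo forward
    steps.\<close>
  have "p = (f ^^ (m * n)) p" using funpow_fixed_point[of "f ^^ m" p n, OF m(2)] by (simp add: funpow_mult)
  then have "(g ^^ n) p = (g ^^ n) ((f ^^ (m * n)) p)" by simp
  also have "\<dots> = (f ^^ (m * n - n)) p"
    by (rule funpow_inverse_cancel[where W = W and g = g and f = f, OF inv]) (use orb m(1) in auto)
  finally show ?thesis using orb by simp
qed

lemma orbit_of_funpow_orbit:
  assumes n: "n > 0" and orb: "\<And>m j. j \<le> n \<Longrightarrow> (h ^^ j) (((h ^^ n) ^^ m) p) \<in> C"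
  shows "(h ^^ i) p \<in> C"
proof -
  have "(h ^^ i) p = (h ^^ (i mod n)) ((h ^^ (n * (i div n))) p)"
    by (metis comp_apply funpow_add mod_mult_div_eq)
  also have "\<dots> = (h ^^ (i mod n)) (((h ^^ n) ^^ (i div n)) p)" by (simp add: funpow_mult)
  finally show ?thesis using orb[of "i mod n" "i div n"] n by (simp add: less_imp_le)
qed

section \<open>Maps with finite orbits in a ball\<close>

locale finite_orbits_ball =
  fixes f g :: "complex^2 \<Rightarrow> complex^2" and U V :: "(complex^2) set" and R :: real
  assumes f: "holomorphic_map_on f U" and g: "holomorphic_map_on g V"
    and gf: "\<And>x. x \<in> U \<Longrightarrow> g (f x) = x" and fg: "\<And>x. x \<in> V \<Longrightarrow> f (g x) = x"
    and f0: "f 0 = 0" and R: "R > 0" "cball 0 R \<subseteq> U" "cball 0 R \<subseteq> V"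
    and fin_f: "\<And>p. (\<And>n. (f ^^ n) p \<in> cball 0 R) \<Longrightarrow> finite (range (\<lambda>n. (f ^^ n) p))"
    and fin_g: "\<And>p. (\<And>n. (g ^^ n) p \<in> cball 0 R) \<Longrightarrow> finite (range (\<lambda>n. (g ^^ n) p))"
begin

text \<open>Half the radius leaves room: local constancy of the multiplier needs an open
  neighbourhood of each trapped point in which orbits are still known to be finite.\<close>

definition trapped :: "(complex^2) set" where
  "trapped = {p. \<forall>n. (f ^^ n) p \<in> cball 0 (R / 2)}"

text \<open>Factorials are linearly ordered by divisibility and every period divides one of them, so
  these sets increase with \<open>N\<close> and exhaust the trapped points.\<close>

definition periodic :: "nat \<Rightarrow> (complex^2) set" where
  "periodic N = {p \<in> trapped. (f ^^ fact N) p = p}"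

definition multiplier :: "nat \<Rightarrow> complex^2 \<Rightarrow> complex \<times> complex" where
  "multiplier N p = spec (jac (f ^^ fact N) p)"

lemma half_ball: "cball 0 (R / 2) \<subseteq> ball (0::complex^2) R" "cball 0 (R / 2) \<subseteq> U" "cball 0 (R / 2) \<subseteq> V"
  "ball 0 R \<subseteq> U" "ball 0 R \<subseteq> V"
  using R by (auto simp: subset_iff)

lemma trapped_orbit: "p \<in> trapped \<Longrightarrow> (f ^^ n) p \<in> cball 0 (R / 2)"
  by (simp add: trapped_def)

lemma trapped_orbit_finite: "p \<in> trapped \<Longrightarrow> finite (range (\<lambda>n. (f ^^ n) p))"
  using trapped_orbit half_ball(1) by (intro fin_f) (meson ball_subset_cball subsetD)

lemma half_ball_inverse:
  "x \<in> cball 0 (R / 2) \<Longrightarrow> g (f x) = x" "x \<in> cball 0 (R / 2) \<Longrightarrow> f (g x) = x"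
  using half_ball(2,3) gf fg by (meson subsetD)+

lemma trapped_backward: "p \<in> trapped \<Longrightarrow> (g ^^ n) p \<in> cball 0 (R / 2)"
  by (rule backward_orbit_of_finite_orbit[OF half_ball_inverse(1) trapped_orbit trapped_orbit_finite])

text \<open>Being periodic, a point trapped backward is trapped forward, so it does not matter which
  alternative the continuum construction delivers.\<close>

lemma backward_trapped:
  assumes orb: "\<And>n. (g ^^ n) p \<in> cball 0 (R / 2)"
  shows "p \<in> trapped"
proof -
  have "finite (range (\<lambda>n. (g ^^ n) p))"
    using orb half_ball(1) by (intro fin_g) (meson ball_subset_cball subsetD)
  from backward_orbit_of_finite_orbit[OF half_ball_inverse(2) orb this]
  show ?thesis by (simp add: trapped_def)
qed

lemma compact_periodic: "compact (periodic N)"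
proof -
  have cont: "continuous_on U f" using f by (rule holomorphic_map_on_continuous)
  have oU: "open U" using f by (simp add: holomorphic_map_on_def)
  have "trapped = (\<Inter>n. {p. \<forall>j\<le>n. (f ^^ j) p \<in> cball 0 (R / 2)})" by (auto simp: trapped_def)
  then have cl: "closed trapped"
    using closed_stay_set[OF oU cont half_ball(2)] by (metis (no_types, lifting) closed_INT)
  have "continuous_on trapped (\<lambda>p. (f ^^ fact N) p - p)"
    using trapped_orbit half_ball(2)
    by (intro continuous_on_diff continuous_on_id continuous_on_funpow_stay[OF cont]) blast
  then have "closed {p \<in> trapped. (f ^^ fact N) p - p = 0}"
    using cl by (rule continuous_closed_preimage_constant)
  then have "closed (periodic N)" by (simp add: periodic_def)
  moreover have "periodic N \<subseteq> cball 0 (R / 2)"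
    using trapped_orbit[of _ 0] by (auto simp: periodic_def)
  ultimately show ?thesis by (metis bounded_cball bounded_subset compact_eq_bounded_closed)
qed

lemma holomorphic_iterate: "holomorphic_map_on (f ^^ n) {p. \<forall>j<n. (f ^^ j) p \<in> U}"
  using f by (rule holomorphic_map_on_funpow)

lemma trapped_domain: "p \<in> trapped \<Longrightarrow> p \<in> {p. \<forall>j<n. (f ^^ j) p \<in> U}"
  using trapped_orbit half_ball(2) by blast

lemma continuous_on_multiplier: "continuous_on (periodic N) (multiplier N)"
proof -
  have "continuous_on (periodic N) (jac (f ^^ fact N))"
    using trapped_domain
    by (intro continuous_on_subset[OF continuous_on_jac[OF holomorphic_iterate]]) (auto simp: periodic_def)
  then show ?thesis
    unfolding multiplier_def spec_def trace_def det_2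
    by (intro continuous_intros)
qed

lemma jac_iterate:
  assumes q: "q \<in> trapped" "(f ^^ m) q = q"
  shows "jac (f ^^ (m * l)) q = matpow (jac (f ^^ m) q) l"
  using jac_funpow_fixed[OF holomorphic_iterate trapped_domain[OF q(1)] q(2), of l] by (simp add: funpow_mult)

lemma multiplier_matpow:
  assumes "N \<le> k"
  obtains l where "l > 0" "fact k = fact N * l"
    "\<And>q. q \<in> periodic N \<Longrightarrow> multiplier k q = spec (matpow (jac (f ^^ fact N) q) l)"
proof -
  have "(fact N :: nat) dvd fact k" using assms by (rule fact_dvd)
  then obtain l where l: "(fact k :: nat) = fact N * l" unfolding dvd_def by blast
  moreover have "l > 0" using l by (metis fact_nonzero gr0I mult_0_right)
  moreover have "multiplier k q = spec (matpow (jac (f ^^ fact N) q) l)" if "q \<in> periodic N" for q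
    using that jac_iterate[of q "fact N" l] by (simp add: multiplier_def l periodic_def)
  ultimately show thesis using that by blast
qed

lemma multiplier_locally_constant:
  assumes q: "q \<in> periodic N" and ne: "multiplier N q \<noteq> (2, 1)"
  shows "\<exists>\<epsilon>>0. \<forall>p\<in>periodic N \<inter> ball q \<epsilon>. multiplier N p = multiplier N q"
proof -
  let ?n = "fact N :: nat"
  \<comment> \<open>All intermediate points are kept in the ball, so that an orbit of the iterate
    inside \<open>O'\<close> comes from a full orbit of \<open>f\<close> or \<open>g\<close> in the
    ball, to which finiteness applies.\<close>
  define B where "B = (\<lambda>h :: complex^2 \<Rightarrow> complex^2. {p. \<forall>j\<le>?n. (h ^^ j) p \<in> ball 0 R})"
  define O' where "O' = B f \<inter> B g"
  have "open (B f)" "open (B g)"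
    unfolding B_def
    by (rule open_stay_set[OF holomorphic_map_on_continuous[OF f] open_ball half_ball(4)]
        open_stay_set[OF holomorphic_map_on_continuous[OF g] open_ball half_ball(5)])+
  then have oO: "open O'" by (simp add: O'_def open_Int)
  have inf: "(f ^^ j) p \<in> U" and ing: "(g ^^ j) p \<in> V" if "p \<in> O'" "j < ?n" for p j
    using that half_ball(4,5) by (auto simp: O'_def B_def less_imp_le simp del: mem_ball)
  have fin: "finite (range (\<lambda>m. ((h ^^ ?n) ^^ m) p))"
    if fin_h: "(\<And>n. (h ^^ n) p \<in> cball 0 R) \<Longrightarrow> finite (range (\<lambda>n. (h ^^ n) p))"
      and orb: "\<And>m. ((h ^^ ?n) ^^ m) p \<in> B h" for h p
  proof -
    have "(h ^^ i) p \<in> cball 0 R" for i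
      by (rule orbit_of_funpow_orbit[of ?n]) (use orb in \<open>auto simp: B_def less_imp_le\<close>)
    then have "finite (range (\<lambda>n. (h ^^ n) p))" by (rule fin_h)
    moreover have "range (\<lambda>m. ((h ^^ ?n) ^^ m) p) \<subseteq> range (\<lambda>n. (h ^^ n) p)" by (auto simp: funpow_mult)
    ultimately show ?thesis by (rule finite_subset[rotated])
  qed
  have "\<exists>\<epsilon>>0. \<forall>p\<in>ball q \<epsilon>. (f ^^ ?n) p = p \<longrightarrow> spec (jac (f ^^ ?n) p) = spec (jac (f ^^ ?n) q)"
  proof (rule spec_locally_constant_on_fixed_points[where N = O' and H = "g ^^ ?n"])
    show "holomorphic_map_on (f ^^ ?n) O'"
      by (rule holomorphic_map_on_subset[OF holomorphic_iterate oO]) (use inf in blast)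
    show "holomorphic_map_on (g ^^ ?n) O'"
      by (rule holomorphic_map_on_subset[OF holomorphic_map_on_funpow[OF g] oO]) (use ing in blast)
    show "q \<in> O'"
      using q trapped_orbit trapped_backward half_ball(1) unfolding O'_def B_def periodic_def by blast
    show "(f ^^ ?n) q = q" using q by (simp add: periodic_def)
    fix p
    show "(g ^^ ?n) ((f ^^ ?n) p) = p" if "p \<in> O'"
      using funpow_inverse_cancel[where W = U and g = g and f = f, OF gf inf[OF that], of ?n ?n] by simp
    show "(f ^^ ?n) ((g ^^ ?n) p) = p" if "p \<in> O'"
      using funpow_inverse_cancel[where W = V and g = f and f = g, OF fg ing[OF that], of ?n ?n] by simp
    show "finite (range (\<lambda>m. ((f ^^ ?n) ^^ m) p))" if "\<And>m. ((f ^^ ?n) ^^ m) p \<in> O'"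
      using that by (intro fin fin_f) (auto simp: O'_def)
    show "finite (range (\<lambda>m. ((g ^^ ?n) ^^ m) p))" if "\<And>m. ((g ^^ ?n) ^^ m) p \<in> O'"
      using that by (intro fin fin_g) (auto simp: O'_def)
  qed (use ne in \<open>simp add: multiplier_def\<close>)
  then show ?thesis by (auto simp: periodic_def multiplier_def)
qed

lemma trapped_unity_free:
  assumes "q \<in> trapped"
  shows "\<exists>N. q \<in> periodic N \<and> unity_free (multiplier N q)"
proof -
  obtain m where m: "m > 0" "(f ^^ m) q = q"
    by (rule periodic_of_finite_orbit[where W = U and g = g and f = f and p = q])
       (use gf trapped_orbit[OF assms] half_ball(2) trapped_orbit_finite[OF assms] in blast)+
  obtain n where n: "n > 0" "\<And>l. n dvd l \<Longrightarrow> l > 0 \<Longrightarrow> unity_free (spec (matpow (jac (f ^^ m) q) l))"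
    by (rule ex_unity_free_power) (rule that; assumption)
  \<comment> \<open>\<open>m\<close> is a period of \<open>q\<close> and \<open>n\<close> removes
    the nontrivial roots of unity from the spectrum; the factorial of m n is a multiple of both at
    once.\<close>
  have "m * n dvd fact (m * n)" using m(1) n(1) by (intro dvd_fact) auto
  then obtain k where k: "(fact (m * n) :: nat) = m * (n * k)" unfolding dvd_def mult.assoc by blast
  then have "n * k > 0" by (metis fact_nonzero gr0I mult_0_right)
  then have "unity_free (multiplier (m * n) q)"
    using n(2)[of "n * k"] jac_iterate[OF assms m(2), of "n * k"] by (simp add: multiplier_def k)
  moreover have "q \<in> periodic (m * n)"
    using assms funpow_fixed_point[of "f ^^ m" q "n * k", OF m(2)] by (simp add: periodic_def k funpow_mult)
  ultimately show ?thesis by blast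
qed

lemma trapped_continuum_periodic:
  assumes K: "compact K" "connected K" "K \<noteq> {}" "K \<subseteq> trapped"
  shows "\<exists>N. K \<subseteq> periodic N"
proof (rule continuum_in_single_stratum[where good = unity_free and \<tau> = multiplier and e = "(2, 1)", OF K(1-3)
      compact_periodic continuous_on_multiplier])
  show "q \<in> periodic k \<and> unity_free (multiplier k q)"
    if q: "q \<in> periodic N" "unity_free (multiplier N q)" "N \<le> k" for N k q
  proof -
    obtain l where l: "l > 0" "fact k = fact N * l"
      "\<And>q. q \<in> periodic N \<Longrightarrow> multiplier k q = spec (matpow (jac (f ^^ fact N) q) l)"
      by (rule multiplier_matpow[OF q(3)]) (rule that; assumption)
    have "q \<in> trapped" "(f ^^ fact N) q = q" using q(1) by (auto simp: periodic_def)
    then have "q \<in> periodic k" using funpow_fixed_point[of "f ^^ fact N" q l] by (simp add: periodic_def l(2) funpow_mult)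
    then show ?thesis using unity_free_matpow l(1,3) q(1,2) by (simp add: multiplier_def)
  qed
  show "\<exists>\<epsilon>>0. periodic k \<inter> ball q \<epsilon> \<subseteq> periodic N"
    if q: "q \<in> periodic N" "unity_free (multiplier N q)" "N \<le> k" for N k q
  proof -
    obtain l where l: "l > 0" "fact k = fact N * l"
      "\<And>q. q \<in> periodic N \<Longrightarrow> multiplier k q = spec (matpow (jac (f ^^ fact N) q) l)"
      by (rule multiplier_matpow[OF q(3)]) (rule that; assumption)
    have qN: "q \<in> trapped" "(f ^^ fact N) q = q" using q(1) by (auto simp: periodic_def)
    have "det (\<Sum>i<l. matpow (jac (f ^^ fact N) q) i) \<noteq> 0"
      using q(2) l(1) by (intro det_sum_matpow_nonzero) (simp_all add: multiplier_def)
    from fixed_points_of_funpow_near[OF holomorphic_iterate trapped_domain[OF qN(1)] qN(2) l(1) this]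
    obtain \<delta> where \<delta>: "\<delta> > 0" "\<forall>p\<in>ball q \<delta>. ((f ^^ fact N) ^^ l) p = p \<longrightarrow> (f ^^ fact N) p = p" by blast
    have "periodic k \<inter> ball q \<delta> \<subseteq> periodic N"
      using \<delta>(2) by (auto simp: periodic_def l(2) funpow_mult simp del: mem_ball)
    then show ?thesis using \<delta>(1) by blast
  qed
  show "multiplier k q = (2, 1)" if q: "q \<in> periodic N" "multiplier N q = (2, 1)" "N \<le> k" for N k q
    using multiplier_matpow[OF q(3)] q(1,2) spec_matpow_unipotent by (metis multiplier_def)
  show "\<exists>Z. finite Z \<and> (\<forall>q\<in>periodic N. multiplier k q = (2, 1) \<longrightarrow> multiplier N q \<in> Z)" if "N \<le> k" for N k
  proof -
    obtain l where l: "l > 0" "fact k = fact N * l"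
      "\<And>q. q \<in> periodic N \<Longrightarrow> multiplier k q = spec (matpow (jac (f ^^ fact N) q) l)"
      by (rule multiplier_matpow[OF \<open>N \<le> k\<close>]) (rule that; assumption)
    show ?thesis
      using finite_spec_roots_of_unipotent[OF l(1)] l(3)
      by (intro exI[of _ "{spec J | J. spec (matpow J l) = (2, 1)}"]) (auto simp: multiplier_def)
  qed
qed (use K(4) trapped_unity_free multiplier_locally_constant unity_free_unipotent in blast)+

theorem nonisolated_periodic_point:
  obtains m where "m \<ge> 1" "\<not> 0 isolated_in {z. (f ^^ m) z = z}"
proof -
  have oUV: "open U" "open V" "continuous_on U f" "continuous_on V g"
    using f g by (auto simp: holomorphic_map_on_def[of _ U] holomorphic_map_on_def[of _ V] intro: holomorphic_map_on_continuous)
  have "R / 2 > 0" using R by simp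
  from continuum_of_trapped_points[OF oUV(1,3,2,4) gf fg f0 this half_ball(2,3)]
  obtain K where K: "compact K" "connected K" "0 \<in> K" "K \<inter> sphere 0 (R / 2) \<noteq> {}"
    "K \<subseteq> {p. \<forall>j. (f ^^ j) p \<in> cball 0 (R / 2)} \<or> K \<subseteq> {p. \<forall>j. (g ^^ j) p \<in> cball 0 (R / 2)}"
    by blast
  have "K \<subseteq> trapped" using K(5) backward_trapped by (auto simp: trapped_def)
  then obtain N where N: "K \<subseteq> periodic N" using trapped_continuum_periodic[OF K(1,2)] K(3) by blast
  have "\<not> 0 isolated_in {z. (f ^^ fact N) z = z}"
  proof
    assume "0 isolated_in {z. (f ^^ fact N) z = z}"
    then obtain T where T: "open T" "T \<inter> {z. (f ^^ fact N) z = z} = {0}" unfolding isolated_in_def by blast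
    \<comment> \<open>Isolation would make {0} clopen in the connected set \<open>K\<close>, which
      also reaches the sphere.\<close>
    have "K \<inter> T = {0}" using N T(2) K(3) by (auto simp: periodic_def)
    then have "openin (top_of_set K) {0}" using T(1) by (metis openin_open_Int)
    moreover have "closedin (top_of_set K) {0}" using K(3) by (intro closed_subset) auto
    ultimately have "K = {0}" using K(2) unfolding connected_clopen by (metis insert_not_empty)
    then show False using K(4) R(1) by simp
  qed
  then show thesis using that[of "fact N"] by (simp add: fact_ge_1)
qed

end

section \<open>From maps to germs\<close>

lemma germ_rel_refl: "local_biholomorphism f U V \<Longrightarrow> germ_rel f f"
  by (auto simp: germ_rel_def)

lemma germ_rel_funpow: "germ_rel f f \<Longrightarrow> germ_rel (f ^^ m) (f ^^ m)"
proof (induction m)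
  case 0
  then show ?case using germ_rel_refl[OF local_biholomorphism_id] by (simp add: id_def)
next
  case (Suc m)
  then show ?case using germ_rel_compose[of f f "f ^^ m" "f ^^ m"] by (simp only: funpow.simps)
qed

lemma abs_diff_germ_power:
  assumes "germ_rel f f"
  shows "abs_diff_germ f ^ m = abs_diff_germ (f ^^ m)"
proof (induction m)
  case 0
  show ?case by (simp only: funpow.simps power_0 one_diff_germ_def)
next
  case (Suc m)
  then show ?case
    using times_diff_germ.abs_eq[OF assms germ_rel_funpow[OF assms, of m]] by (simp only: funpow.simps power_Suc)
qed

theorem corollary1:
  fixes F :: diff_germ
  assumes "\<And>m::nat. m \<ge> 1 \<Longrightarrow> isolated_fixed_point_0 (F ^ m)"
  shows "\<not> finite_orbits_property F"
proof
  assume "finite_orbits_property F"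
  then obtain f U V A where rep: "local_biholomorphism f U V" "abs_diff_germ f = F"
    and A: "A \<subseteq> U \<inter> V" "0 \<in> interior A" and fin: "finite_orbits_in f U A"
    unfolding finite_orbits_property_def representative_def by blast
  define g where "g = inv_into U f"
  have bij: "bij_betw f U V" and f: "holomorphic_map_on f U" and g: "holomorphic_map_on g V" and f0: "f 0 = 0"
    using rep(1) by (auto simp: local_biholomorphism_def biholomorphism_def g_def)
  obtain R where R: "R > 0" "cball 0 R \<subseteq> A"
    using A(2) by (meson mem_interior_cball)
  have orbit: "finite (range (\<lambda>n. (h ^^ n) p))"
    if orb: "\<And>n. (h ^^ n) p \<in> cball 0 R" and h: "h = f \<or> h = g" for h p
  proof -
    have "range (\<lambda>n. (h ^^ n) p) \<subseteq> pos_orbit h A p" using orb R(2) unfolding pos_orbit_def by blast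
    also have "\<dots> \<subseteq> orbit_in f U A p" using h by (auto simp: orbit_in_def g_def)
    finally have sub: "range (\<lambda>n. (h ^^ n) p) \<subseteq> orbit_in f U A p" .
    have "(h ^^ 0) p \<in> A" using orb R(2) by blast
    then have "finite (orbit_in f U A p)" using fin by (simp add: finite_orbits_in_def)
    with sub show ?thesis by (rule finite_subset)
  qed
  interpret finite_orbits_ball f g U V R
  proof
    show "g (f x) = x" if "x \<in> U" for x using bij that by (simp add: g_def bij_betw_inv_into_left)
    show "f (g x) = x" if "x \<in> V" for x using bij that by (simp add: g_def bij_betw_inv_into_right)
    show "cball 0 R \<subseteq> U" "cball 0 R \<subseteq> V" using R(2) A(1) by auto
  qed (use f g f0 R(1) orbit in auto)
  obtain m where m: "m \<ge> 1" "\<not> 0 isolated_in {z. (f ^^ m) z = z}" by (rule nonisolated_periodic_point)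
  have "germ_rel f f" using rep(1) by (rule germ_rel_refl)
  then have "isolated_fixed_point_0 (F ^ m) \<longleftrightarrow> 0 isolated_in {z. (f ^^ m) z = z}"
    using isolated_fixed_point_0.abs_eq[OF germ_rel_funpow, of f m] by (simp add: abs_diff_germ_power flip: rep(2))
  then show False using assms[OF m(1)] m(2) by simp
qed

end
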